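(* Let $\varphi$ be an $H$-flow on $(M,d)$. For a compact subset $K\subset M$ with nonempty interior and $\sigma>0$, the quantity $$h_{\mathrm{Gur}}(\varphi,K,\sigma)=\limsup_{L\to\infty}\frac1L\log\#\mathcal P_K(L,L+\sigma)$$ depends neither on $\sigma>0$ nor on $K$; denote it by $h_{\mathrm{Gur}}(\varphi)$. Moreover, for every compact subset $K\subset M$ with nonempty interior and every $\sigma\ge5\tau_K$, where $\tau_K$ is the period of the shortest periodic orbit with period at least $1$ that intersects $K$, this is a true limit: $$h_{\mathrm{Gur}}(\varphi)=\lim_{L\to+\infty}\frac1L\log\#\mathcal P_K(L,L+\sigma).$$
   Context: **Setting.** $(M,g)$ is a complete connected (not necessarily compact) Riemannian manifold with associated distance $d$; $B(x,r)$ is the open ball. **$H$-flow.** An $H$-flow is a $C^1$ flow $(\varphi_t)_{t\in\mathbb R}$ on a complete Riemannian manifold such that: (1) there is a constant $lip(\varphi)$ with $d(\varphi_\tau(x),\varphi_\tau(y))\le lip(\varphi)\,d(x,y)$ for all $x,y\in M$, $\tau\in[-1,1]$; (2) there exist $0<a\le b$ such that for every $x\in M$ there is $\rho>0$ with $a|t|\le d(x,\varphi_t(x))\le b|t|$ for all $t\in[-\rho,\rho]$; (3) (transitivity) for all nonempty open $U,V\subset M$ and every $T>0$ there is $t\ge T$ with $\varphi_t(U)\cap V\ne\emptyset$; (4) (finite exact shadowing) for every compact $K\subset M$, $\delta>0$ and integer $N\ge1$ there is $\eta>0$ such that, for all $x_1,\dots,x_N\in K$ and $t_1,\dots,t_N\ge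 0$ with $d(\varphi_{t_i}(x_i),x_{i+1})<\eta$ for $1\le i\le N-1$, there is $y\in M$ with $d(\varphi_{s+\sum_{j=1}^{i-1}t_j}(y),\varphi_s(x_i))<\delta$ for all $1\le i\le N$ and $0\le s\le t_i$; (5) (closing lemma) for every $\epsilon>0$ and $x\in M$ there exist $\delta>0$ and $T_{\min}>0$ such that for every $y\in B(x,\epsilon)$ and $t\ge T_{\min}$ with $d(\varphi_t(y),y)\le\delta$ there exist $z\in B(y,\epsilon)$ and $\tau\in[t-\epsilon,t+\epsilon]$ with $\varphi_\tau(z)=z$ and $d(\varphi_s(z),\varphi_s(y))\le\epsilon$ for all $0\le s\le t$; (6) (expansivity) for every $\nu>0$ there is $\epsilon>0$ such that, for all $x,y\in M$, if there is a continuous map $s:\mathbb R\to\mathbb R$ with $s(0)=0$ and $d(\varphi_t(x),\varphi_{s(t)}(y))\le\epsilon$ for all $t\in\mathbb R$, then $y=\varphi_\tau(x)$ for some $\tau\in[-\nu,\nu]$. **Periodic orbits.** A periodic orbit $\gamma$ is a pair $(\{\varphi_t(x):t\in\mathbb R\},T)$ with $T>0$, $\varphi_T(x)=x$; its period is $\ell(\gamma)=T$ (so multiples of an orbit count as distinct periodic orbits). For $K\subset M$ compact, $\mathcal P_K(T_0,T_1)$ is the set of periodic orbits $\gamma$ with $\ell(\gamma)\in[T_0,T_1]$ and $\gamma\cap K\neq\emptyset$. In the definition of $\tau_K$, multiply covered orbits are allowed. *)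

theory Defs
  imports "HOL-Analysis.Analysis"
begin

section \<open>Riemannian manifolds\<close>

text \<open>A manifold is the universe of a metric space type \<open>'a\<close>, with charts valued in a Euclidean
  space \<open>'e\<close> whose dimension is that of the manifold. A chart is a pair of its domain and its
  coordinate map; the coordinate map is irrelevant outside the domain.\<close>

type_synonym ('a, 'e) chart = "'a set \<times> ('a \<Rightarrow> 'e)"

definition chart_im :: "('a, 'e) chart \<Rightarrow> 'e set" where
  "chart_im c = snd c ` fst c"

definition chart_inv :: "('a, 'e) chart \<Rightarrow> 'e \<Rightarrow> 'a" where
  "chart_inv c = inv_into (fst c) (snd c)"

definition transition :: "('a, 'e) chart \<Rightarrow> ('a, 'e) chart \<Rightarrow> 'e \<Rightarrow> 'e" where
  "transition c c' = snd c' \<circ> chart_inv c"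

text \<open>Meant for open \<open>S\<close> and finite-dimensional domains, where continuity of all directional
  derivatives is the same as continuity of the derivative.\<close>

primrec Ck_on :: "nat \<Rightarrow> ('b::euclidean_space \<Rightarrow> 'c::real_normed_vector) \<Rightarrow> 'b set \<Rightarrow> bool" where
  "Ck_on 0 f S \<longleftrightarrow> continuous_on S f"
| "Ck_on (Suc k) f S \<longleftrightarrow>
     (\<forall>x\<in>S. f differentiable (at x)) \<and>
     (\<forall>v. Ck_on k (\<lambda>x. frechet_derivative f (at x) v) S)"

definition Cinf_on :: "('b::euclidean_space \<Rightarrow> 'c::real_normed_vector) \<Rightarrow> 'b set \<Rightarrow> bool" where
  "Cinf_on f S \<longleftrightarrow> (\<forall>k. Ck_on k f S)"

definition smooth_atlas :: "('a::metric_space, 'e::euclidean_space) chart set \<Rightarrow> bool" where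
  "smooth_atlas A \<longleftrightarrow>
     (\<Union>c\<in>A. fst c) = UNIV \<and>
     (\<forall>c\<in>A. open (fst c) \<and> open (chart_im c) \<and>
        homeomorphism (fst c) (chart_im c) (snd c) (chart_inv c)) \<and>
     (\<forall>c\<in>A. \<forall>c'\<in>A. Cinf_on (transition c c') (snd c ` (fst c \<inter> fst c')))"

text \<open>\<open>g c u\<close> is the inner product, expressed in the chart \<open>c\<close>, on the tangent space at the point
  with coordinates \<open>u\<close>.\<close>

definition riemannian_metric ::
  "('a::metric_space, 'e::euclidean_space) chart set \<Rightarrow>
   (('a, 'e) chart \<Rightarrow> 'e \<Rightarrow> 'e \<Rightarrow> 'e \<Rightarrow> real) \<Rightarrow> bool" where
  "riemannian_metric A g \<longleftrightarrow>
     (\<forall>c\<in>A. \<forall>u\<in>chart_im c.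
        bilinear (g c u) \<and> (\<forall>v w. g c u v w = g c u w v) \<and> (\<forall>v. v \<noteq> 0 \<longrightarrow> g c u v v > 0)) \<and>
     (\<forall>c\<in>A. \<forall>v w. Cinf_on (\<lambda>u. g c u v w) (chart_im c)) \<and>
     (\<forall>c\<in>A. \<forall>c'\<in>A. \<forall>u \<in> snd c ` (fst c \<inter> fst c'). \<forall>v w.
        g c u v w = g c' (transition c c' u)
          (frechet_derivative (transition c c') (at u) v)
          (frechet_derivative (transition c c') (at u) w))"

text \<open>Curves of class \<open>C\<^sup>1\<close> on a closed interval, with one-sided derivatives at its endpoints.\<close>

definition C1_curve_on ::
  "('a::metric_space, 'e::euclidean_space) chart set \<Rightarrow> (real \<Rightarrow> 'a) \<Rightarrow> real \<Rightarrow> real \<Rightarrow> bool" where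
  "C1_curve_on A \<gamma> a b \<longleftrightarrow>
     continuous_on {a..b} \<gamma> \<and>
     (\<forall>c\<in>A. \<exists>D. continuous_on ({a..b} \<inter> \<gamma> -` fst c) D \<and>
        (\<forall>t \<in> {a..b} \<inter> \<gamma> -` fst c.
           ((snd c \<circ> \<gamma>) has_vector_derivative D t) (at t within {a..b})))"

definition piecewise_C1_curve ::
  "('a::metric_space, 'e::euclidean_space) chart set \<Rightarrow> (real \<Rightarrow> 'a) \<Rightarrow> bool" where
  "piecewise_C1_curve A \<gamma> \<longleftrightarrow>
     path \<gamma> \<and>
     (\<exists>S. finite S \<and>
        (\<forall>a b. 0 \<le> a \<and> a < b \<and> b \<le> 1 \<and> {a<..<b} \<inter> S = {} \<longrightarrow> C1_curve_on A \<gamma> a b))"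

text \<open>For a Riemannian metric the speed does not depend on the chosen chart. It is meaningless at
  the finitely many corners, which do not affect the length.\<close>

definition curve_speed ::
  "('a::metric_space, 'e::euclidean_space) chart set \<Rightarrow>
   (('a, 'e) chart \<Rightarrow> 'e \<Rightarrow> 'e \<Rightarrow> 'e \<Rightarrow> real) \<Rightarrow> (real \<Rightarrow> 'a) \<Rightarrow> real \<Rightarrow> real" where
  "curve_speed A g \<gamma> t =
     (let c = (SOME c. c \<in> A \<and> \<gamma> t \<in> fst c);
          v = vector_derivative (snd c \<circ> \<gamma>) (at t)
      in sqrt (g c (snd c (\<gamma> t)) v v))"

definition curve_length ::
  "('a::metric_space, 'e::euclidean_space) chart set \<Rightarrow>
   (('a, 'e) chart \<Rightarrow> 'e \<Rightarrow> 'e \<Rightarrow> 'e \<Rightarrow> real) \<Rightarrow> (real \<Rightarrow> 'a) \<Rightarrow> real" where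
  "curve_length A g \<gamma> = integral {0..1} (curve_speed A g \<gamma>)"

definition riemannian_dist ::
  "('a::metric_space, 'e::euclidean_space) chart set \<Rightarrow>
   (('a, 'e) chart \<Rightarrow> 'e \<Rightarrow> 'e \<Rightarrow> 'e \<Rightarrow> real) \<Rightarrow> 'a \<Rightarrow> 'a \<Rightarrow> real" where
  "riemannian_dist A g x y =
     Inf {curve_length A g \<gamma> | \<gamma>.
            piecewise_C1_curve A \<gamma> \<and> pathstart \<gamma> = x \<and> pathfinish \<gamma> = y}"

text \<open>The Hausdorff property and, by connectedness, second countability come for free because the
  manifold topology is the topology of the metric.\<close>

locale complete_riemannian_manifold =
  fixes A :: "('a::metric_space, 'e::euclidean_space) chart set"
    and g :: "('a, 'e) chart \<Rightarrow> 'e \<Rightarrow> 'e \<Rightarrow> 'e \<Rightarrow> real"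
  assumes atlas: "smooth_atlas A"
    and metric: "riemannian_metric A g"
    and connected_UNIV: "connected (UNIV :: 'a set)"
    and dist_eq: "\<And>x y :: 'a. dist x y = riemannian_dist A g x y"
    and complete_UNIV: "complete (UNIV :: 'a set)"

section \<open>H-flows\<close>

definition C1_flow ::
  "('a::metric_space, 'e::euclidean_space) chart set \<Rightarrow> (real \<Rightarrow> 'a \<Rightarrow> 'a) \<Rightarrow> bool" where
  "C1_flow A \<phi> \<longleftrightarrow>
     (\<forall>x. \<phi> 0 x = x) \<and>
     (\<forall>s t x. \<phi> (s + t) x = \<phi> s (\<phi> t x)) \<and>
     continuous_on UNIV (\<lambda>(t, x). \<phi> t x) \<and>
     (\<forall>c\<in>A. \<forall>c'\<in>A.
        Ck_on 1 (\<lambda>(t, u). snd c' (\<phi> t (chart_inv c u)))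
          {(t, u). u \<in> chart_im c \<and> \<phi> t (chart_inv c u) \<in> fst c'})"

locale H_flow = complete_riemannian_manifold A g
  for A :: "('a::metric_space, 'e::euclidean_space) chart set"
    and g :: "('a, 'e) chart \<Rightarrow> 'e \<Rightarrow> 'e \<Rightarrow> 'e \<Rightarrow> real" +
  fixes \<phi> :: "real \<Rightarrow> 'a \<Rightarrow> 'a"
  assumes C1_flow: "C1_flow A \<phi>"
    and lipschitz:
      "\<exists>lip. \<forall>x y. \<forall>\<tau>\<in>{-1..1}. dist (\<phi> \<tau> x) (\<phi> \<tau> y) \<le> lip * dist x y"
    and speed_bounds:
      "\<exists>a b. 0 < a \<and> a \<le> b \<and>
         (\<forall>x. \<exists>\<rho>>0. \<forall>t\<in>{-\<rho>..\<rho>}. a * \<bar>t\<bar> \<le> dist x (\<phi> t x) \<and> dist x (\<phi> t x) \<le> b * \<bar>t\<bar>)"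
    and transitive:
      "\<And>U V T. open U \<Longrightarrow> U \<noteq> {} \<Longrightarrow> open V \<Longrightarrow> V \<noteq> {} \<Longrightarrow> T > 0 \<Longrightarrow>
         \<exists>t\<ge>T. \<phi> t ` U \<inter> V \<noteq> {}"
    and finite_exact_shadowing:
      "\<And>K \<delta> N. compact K \<Longrightarrow> \<delta> > 0 \<Longrightarrow> N \<ge> 1 \<Longrightarrow>
         \<exists>\<eta>>0. \<forall>(x :: nat \<Rightarrow> 'a) (t :: nat \<Rightarrow> real).
           (\<forall>i\<in>{1..N}. x i \<in> K \<and> t i \<ge> 0) \<and>
           (\<forall>i. 1 \<le> i \<and> i < N \<longrightarrow> dist (\<phi> (t i) (x i)) (x (i + 1)) < \<eta>) \<longrightarrow>
           (\<exists>y. \<forall>i\<in>{1..N}. \<forall>s\<in>{0..t i}.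
              dist (\<phi> (s + (\<Sum>j\<in>{1..<i}. t j)) y) (\<phi> s (x i)) < \<delta>)"
    and closing_lemma:
      "\<And>\<epsilon> x. \<epsilon> > 0 \<Longrightarrow>
         \<exists>\<delta>>0. \<exists>T_min>0. \<forall>y\<in>ball x \<epsilon>. \<forall>t\<ge>T_min. dist (\<phi> t y) y \<le> \<delta> \<longrightarrow>
           (\<exists>z\<in>ball y \<epsilon>. \<exists>\<tau>\<in>{t - \<epsilon>..t + \<epsilon>}.
              \<phi> \<tau> z = z \<and> (\<forall>s\<in>{0..t}. dist (\<phi> s z) (\<phi> s y) \<le> \<epsilon>))"
    and expansive:
      "\<And>\<nu>. \<nu> > 0 \<Longrightarrow>
         \<exists>\<epsilon>>0. \<forall>x y.
           (\<exists>s :: real \<Rightarrow> real. continuous_on UNIV s \<and> s 0 = 0 \<and>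
              (\<forall>t. dist (\<phi> t x) (\<phi> (s t) y) \<le> \<epsilon>)) \<longrightarrow>
           (\<exists>\<tau>\<in>{-\<nu>..\<nu>}. y = \<phi> \<tau> x)"

section \<open>Periodic orbits and Gurevich entropy\<close>

text \<open>The period need not be the minimal one: an orbit traversed several times is a different
  periodic orbit.\<close>

definition periodic_orbits :: "(real \<Rightarrow> 'a \<Rightarrow> 'a) \<Rightarrow> ('a set \<times> real) set" where
  "periodic_orbits \<phi> = {(range (\<lambda>t. \<phi> t x), T) | x T. T > 0 \<and> \<phi> T x = x}"

definition orbits_meeting ::
  "(real \<Rightarrow> 'a \<Rightarrow> 'a) \<Rightarrow> 'a set \<Rightarrow> real \<Rightarrow> real \<Rightarrow> ('a set \<times> real) set" where
  "orbits_meeting \<phi> K T0 T1 =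
     {\<gamma> \<in> periodic_orbits \<phi>. snd \<gamma> \<in> {T0..T1} \<and> fst \<gamma> \<inter> K \<noteq> {}}"

text \<open>Logarithm of a cardinality, with \<open>log 0 = -\<infinity>\<close> and \<open>log \<infinity> = \<infinity>\<close>; neither \<^term>\<open>card\<close> of an
  infinite set nor \<open>ln 0\<close> is used.\<close>

definition log_card :: "'b set \<Rightarrow> ereal" where
  "log_card P = (if infinite P then \<infinity> else if P = {} then - \<infinity> else ereal (ln (real (card P))))"

definition orbit_growth ::
  "(real \<Rightarrow> 'a \<Rightarrow> 'a) \<Rightarrow> 'a set \<Rightarrow> real \<Rightarrow> real \<Rightarrow> ereal" where
  "orbit_growth \<phi> K \<sigma> L = ereal (1 / L) * log_card (orbits_meeting \<phi> K L (L + \<sigma>))"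

definition h_Gur :: "(real \<Rightarrow> 'a \<Rightarrow> 'a) \<Rightarrow> 'a set \<Rightarrow> real \<Rightarrow> ereal" where
  "h_Gur \<phi> K \<sigma> = Limsup at_top (orbit_growth \<phi> K \<sigma>)"

text \<open>For an H-flow and a compact \<open>K\<close> with nonempty interior, the infimum is over a nonempty set
  and is attained.\<close>

definition shortest_period :: "(real \<Rightarrow> 'a \<Rightarrow> 'a) \<Rightarrow> 'a set \<Rightarrow> real" where
  "shortest_period \<phi> K = Inf {snd \<gamma> | \<gamma>. \<gamma> \<in> periodic_orbits \<phi> \<and> snd \<gamma> \<ge> 1 \<and> fst \<gamma> \<inter> K \<noteq> {}}"

end

theory Submission
  imports Defs
begin

text \<open>The idea is to glue periodic orbits. By transitivity, finitely many transition arcs connect a point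
  \<open>p\<close> with small cells covering a compact set \<open>X\<close>. A periodic orbit based in \<open>X\<close> starts and ends in one
  cell, so two of them, preceded, separated and followed by transition arcs, form a pseudo-orbit of
  five pieces from \<open>p\<close> back to \<open>p\<close>; exact shadowing and the closing lemma replace it by a periodic orbit
  (\<open>orbit_gluing_exists\<close>). Shadowing is used with five pieces only, hence with uniform constants.
  Distinct periodic orbits of nearly equal period are told apart by expansivity, so the glued orbit and
  its starting point determine the two given orbits up to the finitely many transition times
  (\<open>glued_first_eq\<close>, \<open>glued_second_eq\<close>).

  Independence of \<open>K\<close> and \<open>\<sigma>\<close>: given compact sets \<open>K1\<close>, \<open>K2\<close> and \<open>p\<close> in the interior of \<open>K2\<close>, gluing turns orbits meeting \<open>K1\<close> into
  orbits meeting \<open>K2\<close> whose period is larger by a bounded amount. An orbit of period about \<open>L\<close> arises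
  in this way from at most \<open>O(L)\<close> orbits, the number of its distinguishable starting points
  (\<open>orbits_meeting_transfer\<close>), and a linear factor does not change the exponential growth rate.

  Existence of the limit: gluing makes the numbers of orbits superadditive on the logarithmic scale.
  Counting orbits would lose a factor \<open>O(L)\<close> at every step, too much for infinitely many steps.
  Therefore the count is one of separated starting points (\<open>arc_family\<close>), which loses only a constant
  factor (\<open>arc_family_product\<close>). Starting from one length \<open>L0\<close> at which the growth is close to the limit
  superior, gluing \<open>n\<close> times gives a family whose length is at most \<open>(n + 1) (L0 + C)\<close> and
  whose cardinality is at least an \<open>(n + 1)\<close>-st power, hence nearly the same growth. A last gluing
  with \<open>k\<close> rounds of a short periodic orbit reaches every large period up to an error of about the
  period of that orbit (\<open>orbits_of_arc_family\<close>), which explains the condition on \<open>\<sigma>\<close>.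

  Cardinalities are compared through finite subsets, so it is not needed that the sets of periodic
  orbits are finite.\<close>

section \<open>Cells, windows and logarithmic cardinalities\<close>

lemma compact_cells:
  fixes X :: "'a::metric_space set"
  assumes "compact X" "r > 0"
  obtains k cell where "finite k" "k \<subseteq> X" "\<And>x. x \<in> X \<Longrightarrow> cell x \<in> k \<and> dist (cell x) x < r"
proof -
  have "X \<subseteq> (\<Union>x\<in>X. ball x r)" using assms(2) by auto
  then obtain k where k: "k \<subseteq> X" "finite k" "X \<subseteq> (\<Union>x\<in>k. ball x r)"
    using compactE_image[OF assms(1), of X "\<lambda>x. ball x r"] by auto
  have "\<forall>x. \<exists>c. x \<in> X \<longrightarrow> c \<in> k \<and> dist c x < r" using k(3) by fastforce
  then obtain cell where "\<And>x. x \<in> X \<Longrightarrow> cell x \<in> k \<and> dist (cell x) x < r" by metis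
  with k that show thesis by blast
qed

lemma large_fibre:
  assumes "finite A" "finite B" "\<And>x. x \<in> A \<Longrightarrow> f x \<in> B"
  obtains A' where "A' \<subseteq> A" "card A \<le> card B * card A'" "\<And>x y. x \<in> A' \<Longrightarrow> y \<in> A' \<Longrightarrow> f x = f y"
proof (cases "A = {}")
  case True
  then show ?thesis using that[of "{}"] by simp
next
  case False
  then have "B \<noteq> {}" using assms(3) by blast
  then obtain y where y: "y \<in> B" "card A \<le> card (f -` {y} \<inter> A) * card B"
    using pigeonhole_card[of f A B] assms by blast
  show ?thesis by (rule that[of "f -` {y} \<inter> A"]) (use y in \<open>auto simp: mult.commute\<close>)
qed

text \<open>The number of the window \<open>[L + j w, L + (j + 1) w)\<close> that contains \<open>t\<close>.\<close>

definition window_index :: "real \<Rightarrow> real \<Rightarrow> real \<Rightarrow> int" where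
  "window_index w L t = \<lfloor>(t - L) / w\<rfloor>"

lemma window_index_range:
  assumes "w > 0" "L \<le> t" "t \<le> L + D"
  shows "window_index w L t \<in> {0..\<lfloor>D / w\<rfloor>}"
  using assms unfolding window_index_def
  by (auto intro!: floor_mono divide_right_mono simp: zero_le_floor)

lemma window_index_bounds:
  assumes "w > 0"
  shows "L + of_int (window_index w L t) * w \<le> t" "t < L + of_int (window_index w L t) * w + w"
  using floor_divide_lower[OF assms, of "t - L"] floor_divide_upper[OF assms, of "t - L"]
  unfolding window_index_def by (simp_all add: algebra_simps)

lemma log_card_le_iff:
  "log_card P \<le> ereal a \<longleftrightarrow> (\<forall>\<Gamma>. finite \<Gamma> \<and> \<Gamma> \<subseteq> P \<longrightarrow> real (card \<Gamma>) \<le> exp a)"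
proof (cases "finite P")
  case True
  have fw: "real (card \<Gamma>) \<le> exp a" if "log_card P \<le> ereal a" "\<Gamma> \<subseteq> P" for \<Gamma>
  proof (cases "P = {}")
    case True then show ?thesis using that by simp
  next
    case False
    then have "ln (real (card P)) \<le> a" using that(1) \<open>finite P\<close> by (simp add: log_card_def)
    moreover have "card P > 0" using False \<open>finite P\<close> by (simp add: card_gt_0_iff)
    ultimately have "real (card P) \<le> exp a" by (metis exp_le_cancel_iff exp_ln of_nat_0_less_iff)
    moreover have "card \<Gamma> \<le> card P" using card_mono that(2) \<open>finite P\<close> by blast
    ultimately show ?thesis by linarith
  qed
  have bw: "log_card P \<le> ereal a" if "real (card P) \<le> exp a"
  proof (cases "P = {}")
    case True then show ?thesis by (simp add: log_card_def)
  next
    case False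
    then have "card P > 0" using \<open>finite P\<close> by (simp add: card_gt_0_iff)
    then have "ln (real (card P)) \<le> a" using that by (metis ln_exp ln_mono of_nat_0_less_iff)
    then show ?thesis using False \<open>finite P\<close> by (simp add: log_card_def)
  qed
  show ?thesis using fw bw True by blast
next
  case False
  obtain n :: nat where n: "exp a < real n" using reals_Archimedean2 by blast
  obtain \<Gamma> where "finite \<Gamma>" "card \<Gamma> = n" "\<Gamma> \<subseteq> P" using infinite_arbitrarily_large[OF False] by blast
  then show ?thesis using n False by (auto simp: log_card_def not_le)
qed

lemma orbit_growth_le_iff:
  assumes "L > 0"
  shows "orbit_growth \<phi> K \<sigma> L \<le> ereal c \<longleftrightarrow>
    (\<forall>\<Gamma>. finite \<Gamma> \<and> \<Gamma> \<subseteq> orbits_meeting \<phi> K L (L + \<sigma>) \<longrightarrow> real (card \<Gamma>) \<le> exp (c * L))"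
proof -
  have "ereal (1 / L) * e \<le> ereal c \<longleftrightarrow> e \<le> ereal (c * L)" for e
    using assms by (cases e) (auto simp: field_simps)
  then show ?thesis unfolding orbit_growth_def log_card_le_iff[symmetric] .
qed

lemma orbit_growth_gtI:
  assumes "L > 0" "finite \<Gamma>" "\<Gamma> \<subseteq> orbits_meeting \<phi> K L (L + \<sigma>)" "real (card \<Gamma>) > exp (c * L)"
  shows "orbit_growth \<phi> K \<sigma> L > ereal c"
  using orbit_growth_le_iff[OF assms(1), of \<phi> K \<sigma> c] assms(2-4) by (meson not_le)

lemma sum_pieces:
  fixes f :: "nat \<Rightarrow> real"
  shows "(\<Sum>j\<in>{1..<2}. f j) = f 1" "(\<Sum>j\<in>{1..<4}. f j) = f 1 + f 2 + f 3" "(\<Sum>j\<in>{1..<5}. f j) = f 1 + f 2 + f 3 + f 4"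
  by (simp_all add: eval_nat_numeral atLeastLessThanSuc)

lemma eventually_linear_exp_less:
  fixes a b B :: real
  assumes "a < b"
  shows "\<forall>\<^sub>F L in at_top. B * L * exp (a * L) < exp (b * L)"
  using eventually_gt_at_top[of "\<bar>B\<bar> * 4 / (b - a)^2 + 1"]
proof eventually_elim
  case (elim L)
  define d where "d = b - a"
  have d: "d > 0" using assms by (simp add: d_def)
  have L: "\<bar>B\<bar> * 4 / d^2 < L" "L > 0"
    using elim d by (auto simp: d_def[symmetric] intro: le_less_trans[rotated] add_nonneg_pos)
  have "B * L \<le> \<bar>B\<bar> * L" using L(2) by (intro mult_right_mono) auto
  also have "\<dots> < (d / 2 * L)^2"
    using L d by (simp add: field_simps power2_eq_square)
  also have "\<dots> \<le> exp (d / 2 * L)^2"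
  proof (rule power_mono)
    show "d / 2 * L \<le> exp (d / 2 * L)" using exp_ge_add_one_self[of "d / 2 * L"] by linarith
    show "0 \<le> d / 2 * L" using d L(2) by simp
  qed
  also have "\<dots> = exp (d * L)" by (simp add: exp_double[symmetric])
  finally have "B * L * exp (a * L) < exp (d * L) * exp (a * L)" by simp
  then show ?case by (simp add: exp_add[symmetric] d_def algebra_simps)
qed

section \<open>Elementary properties of H-flows\<close>

context H_flow
begin

lemma flow_0 [simp]: "\<phi> 0 x = x"
  and flow_add: "\<phi> (s + t) x = \<phi> s (\<phi> t x)"
  and flow_continuous: "continuous_on UNIV (\<lambda>(t, x). \<phi> t x)"
  using C1_flow unfolding C1_flow_def by auto

lemma flow_commute: "\<phi> s (\<phi> t x) = \<phi> t (\<phi> s x)"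
  by (metis flow_add add.commute)

lemma flow_multiple:
  assumes "\<phi> T x = x"
  shows "\<phi> (real n * T) x = x"
proof (induction n)
  case (Suc n)
  have "\<phi> (real (Suc n) * T) x = \<phi> (T + real n * T) x" by (simp add: algebra_simps)
  then show ?case using Suc assms by (simp add: flow_add)
qed simp

lemma flow_int_multiple:
  assumes "\<phi> T x = x"
  shows "\<phi> (of_int n * T) x = x"
proof (cases "n \<ge> 0")
  case True
  then show ?thesis using flow_multiple[OF assms, of "nat n"] by simp
next
  case False
  have "\<phi> (of_int n * T) (\<phi> (real (nat (- n)) * T) x) = x"
    using False by (simp add: flow_add[symmetric])
  then show ?thesis using flow_multiple[OF assms] by simp
qed

lemma flow_mod_period:
  assumes "\<phi> T x = x" "T > 0"
  shows "\<phi> t x = \<phi> (t - of_int \<lfloor>t / T\<rfloor> * T) x"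
  by (metis flow_int_multiple[OF assms(1)] flow_add diff_add_cancel)

lemma mod_period_bounds:
  fixes T :: real
  assumes "T > 0"
  shows "0 \<le> t - of_int \<lfloor>t / T\<rfloor> * T" "t - of_int \<lfloor>t / T\<rfloor> * T < T"
  using floor_divide_lower[OF assms, of t] floor_divide_upper[OF assms, of t]
  by (simp_all add: algebra_simps)

text \<open>The speed bound holds near every point at a scale depending on the point; subdividing an
  orbit segment makes it global.\<close>

lemma displacement_bound: "\<exists>B>0. \<forall>x t. dist x (\<phi> t x) \<le> B * \<bar>t\<bar>"
proof -
  obtain a B where "0 < a" "a \<le> B" and
    loc: "\<And>x. \<exists>\<rho>>0. \<forall>t\<in>{-\<rho>..\<rho>}. a * \<bar>t\<bar> \<le> dist x (\<phi> t x) \<and> dist x (\<phi> t x) \<le> B * \<bar>t\<bar>"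
    using speed_bounds by blast
  have B: "B > 0" using \<open>0 < a\<close> \<open>a \<le> B\<close> by linarith
  have pos: "dist (\<phi> u x) (\<phi> v x) \<le> B * (v - u)" if "u \<le> v" for u v x
    using that
  proof (induct rule: Bolzano)
    case (trans p q r)
    have "dist (\<phi> p x) (\<phi> r x) \<le> dist (\<phi> p x) (\<phi> q x) + dist (\<phi> q x) (\<phi> r x)" by (rule dist_triangle)
    then show ?case using trans(1,2) by (simp add: algebra_simps)
  next
    case (local s)
    obtain \<rho> where \<rho>: "\<rho> > 0" "\<forall>t\<in>{-\<rho>..\<rho>}. dist (\<phi> s x) (\<phi> t (\<phi> s x)) \<le> B * \<bar>t\<bar>"
      using loc[of "\<phi> s x"] by blast
    have "dist (\<phi> p x) (\<phi> q x) \<le> B * (q - p)" if "p \<le> s" "s \<le> q" "q - p < \<rho>" for p q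
    proof -
      have "dist (\<phi> s x) (\<phi> (p - s) (\<phi> s x)) \<le> B * \<bar>p - s\<bar>"
        using that by (intro \<rho>(2)[rule_format]) auto
      moreover have "dist (\<phi> s x) (\<phi> (q - s) (\<phi> s x)) \<le> B * \<bar>q - s\<bar>"
        using that by (intro \<rho>(2)[rule_format]) auto
      moreover have "\<phi> (p - s) (\<phi> s x) = \<phi> p x" "\<phi> (q - s) (\<phi> s x) = \<phi> q x"
        by (simp_all flip: flow_add)
      moreover have "dist (\<phi> p x) (\<phi> q x) \<le> dist (\<phi> s x) (\<phi> p x) + dist (\<phi> s x) (\<phi> q x)"
        by (rule dist_triangle3)
      ultimately show ?thesis using that by (simp add: algebra_simps)
    qed
    then show ?case using \<rho>(1) by blast
  qed
  have "dist x (\<phi> t x) \<le> B * \<bar>t\<bar>" for x t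
    using pos[of 0 t x] pos[of t 0 x] by (cases "t \<ge> 0") (auto simp: dist_commute)
  with B show ?thesis by blast
qed

text \<open>Near a point \<open>x\<close> with \<open>\<phi> \<rho> x \<noteq> x\<close> no point returns at a time close to \<open>\<rho>\<close>; a very short period
  would have a multiple close to \<open>\<rho>\<close>.\<close>

lemma no_short_periods:
  assumes "compact X"
  shows "\<exists>\<kappa>>0. \<forall>x\<in>X. \<forall>t. \<phi> t x = x \<and> \<bar>t\<bar> \<le> \<kappa> \<longrightarrow> t = 0"
proof -
  have "\<exists>\<theta>>0. \<exists>r>0. \<forall>y\<in>ball x r. \<forall>t. \<phi> t y = y \<and> 0 < t \<and> t < \<theta> \<longrightarrow> False" for x
  proof -
    obtain a b where "0 < a" "\<exists>\<rho>>0. \<forall>t\<in>{-\<rho>..\<rho>}. a * \<bar>t\<bar> \<le> dist x (\<phi> t x) \<and> dist x (\<phi> t x) \<le> b * \<bar>t\<bar>"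
      using speed_bounds by blast
    then obtain \<rho> where \<rho>0: "\<rho> > 0" "\<forall>t\<in>{-\<rho>..\<rho>}. a * \<bar>t\<bar> \<le> dist x (\<phi> t x) \<and> dist x (\<phi> t x) \<le> b * \<bar>t\<bar>"
      by blast
    then have \<rho>: "\<rho> > 0" "a * \<rho> \<le> dist x (\<phi> \<rho> x)" using \<rho>0(2)[rule_format, of \<rho>] by auto
    then have ne: "dist x (\<phi> \<rho> x) > 0" using \<open>0 < a\<close> by (smt (verit) mult_pos_pos)
    have "continuous_on UNIV (\<lambda>(t, y). dist y (\<phi> t y))"
      using flow_continuous by (auto simp: case_prod_unfold intro!: continuous_intros)
    then have "open ((\<lambda>(t, y). dist y (\<phi> t y)) -` {0<..})"
      by (intro open_vimage) auto
    moreover have "(\<rho>, x) \<in> (\<lambda>(t, y). dist y (\<phi> t y)) -` {0<..}" using ne by simp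
    ultimately obtain U V where UV: "open U" "open V" "(\<rho>, x) \<in> U \<times> V"
      "U \<times> V \<subseteq> (\<lambda>(t, y). dist y (\<phi> t y)) -` {0<..}"
      by (rule open_prod_elim)
    obtain \<theta> where \<theta>: "\<theta> > 0" "ball \<rho> \<theta> \<subseteq> U" using UV(1,3) openE by (metis mem_Sigma_iff)
    obtain r where r: "r > 0" "ball x r \<subseteq> V" using UV(2,3) openE by (metis mem_Sigma_iff)
    have False if y: "y \<in> ball x r" and t: "\<phi> t y = y" "0 < t" "t < \<theta>" for y t
    proof -
      have "\<bar>\<rho> - of_int \<lfloor>\<rho> / t\<rfloor> * t\<bar> < \<theta>" using mod_period_bounds[OF t(2), of \<rho>] t(3) by linarith
      then have "of_int \<lfloor>\<rho> / t\<rfloor> * t \<in> U" using \<theta>(2) by (auto simp: dist_real_def)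
      moreover have "y \<in> V" using y r by blast
      ultimately have "dist y (\<phi> (of_int \<lfloor>\<rho> / t\<rfloor> * t) y) > 0" using UV(4) by fastforce
      then show False using flow_int_multiple[OF t(1)] by simp
    qed
    then show ?thesis using \<theta>(1) r(1) by blast
  qed
  then obtain \<theta> r where \<theta>r: "\<And>x. \<theta> x > 0" "\<And>x. r x > 0"
    "\<And>x y t. y \<in> ball x (r x) \<Longrightarrow> \<phi> t y = y \<Longrightarrow> 0 < t \<Longrightarrow> t < \<theta> x \<Longrightarrow> False"
    by metis
  have "X \<subseteq> (\<Union>x\<in>X. ball x (r x))" using \<theta>r(2) by auto
  then obtain k where k: "k \<subseteq> X" "finite k" "X \<subseteq> (\<Union>x\<in>k. ball x (r x))"
    using compactE_image[OF assms(1), of X "\<lambda>x. ball x (r x)"] by auto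
  define \<kappa> where "\<kappa> = Min (insert 1 (\<theta> ` k)) / 2"
  have min_pos: "Min (insert 1 (\<theta> ` k)) > 0" using k(2) \<theta>r(1) by simp
  have "t = 0" if x: "x \<in> X" and t: "\<phi> t x = x" "\<bar>t\<bar> \<le> \<kappa>" for x t
  proof -
    obtain c where c: "c \<in> k" "x \<in> ball c (r c)" using k(3) x by blast
    have "Min (insert 1 (\<theta> ` k)) \<le> \<theta> c" using c k(2) by simp
    then have lt: "\<bar>t\<bar> < \<theta> c" using t(2) min_pos unfolding \<kappa>_def by linarith
    have "\<phi> (- t) x = x" using flow_int_multiple[OF t(1), of "-1"] by simp
    then show "t = 0" using \<theta>r(3)[OF c(2), of t] \<theta>r(3)[OF c(2), of "- t"] t(1) lt
      by (cases t "0::real" rule: linorder_cases) auto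
  qed
  moreover have "\<kappa> > 0" using min_pos by (simp add: \<kappa>_def)
  ultimately show ?thesis by blast
qed

lemma compact_neighbourhood:
  assumes "compact (X :: 'a set)"
  obtains U C where "open U" "compact C" "X \<subseteq> U" "U \<subseteq> C"
proof -
  have "\<exists>U C. open U \<and> compact C \<and> x \<in> U \<and> U \<subseteq> C" for x :: 'a
  proof -
    obtain c where c: "c \<in> A" "x \<in> fst c" using atlas unfolding smooth_atlas_def by blast
    have op: "open (fst c)" "open (chart_im c)"
      and hom: "homeomorphism (fst c) (chart_im c) (snd c) (chart_inv c)"
      using atlas c(1) unfolding smooth_atlas_def by auto
    have "snd c x \<in> chart_im c" using c(2) by (auto simp: chart_im_def)
    then obtain e where e: "e > 0" "cball (snd c x) e \<subseteq> chart_im c"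
      using op(2) open_contains_cball by blast
    define U where "U = fst c \<inter> snd c -` ball (snd c x) e"
    define C where "C = chart_inv c ` cball (snd c x) e"
    have "open U" unfolding U_def
      using hom op(1) by (metis continuous_on_open_vimage homeomorphism_def inf_commute open_ball)
    moreover have "compact C" unfolding C_def
      using hom e(2) by (intro compact_continuous_image compact_cball)
        (auto simp: homeomorphism_def intro: continuous_on_subset)
    moreover have "x \<in> U" using c(2) e(1) by (simp add: U_def)
    moreover have "U \<subseteq> C"
    proof
      fix y assume y: "y \<in> U"
      then have "y = chart_inv c (snd c y)" using hom by (simp add: U_def homeomorphism_def)
      moreover have "snd c y \<in> cball (snd c x) e" using y by (simp add: U_def)
      ultimately show "y \<in> C" unfolding C_def by blast
    qed
    ultimately show ?thesis by blast
  qed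
  then obtain U C where UC: "\<And>x::'a. open (U x)" "\<And>x. compact (C x)" "\<And>x. x \<in> U x" "\<And>x. U x \<subseteq> C x"
    by metis
  have "X \<subseteq> (\<Union>x\<in>X. U x)" using UC(3) by auto
  then obtain k where k: "k \<subseteq> X" "finite k" "X \<subseteq> (\<Union>x\<in>k. U x)"
    using compactE_image[OF assms, of X U] UC(1) by metis
  show thesis
  proof (rule that[of "\<Union>x\<in>k. U x" "\<Union>x\<in>k. C x"])
    show "(\<Union>x\<in>k. U x) \<subseteq> (\<Union>x\<in>k. C x)" using UC(4) by (rule UN_mono[OF order_refl])
  qed (use k UC in \<open>auto intro!: compact_UN\<close>)
qed

section \<open>Expansivity for closed arcs\<close>

text \<open>Two closed arcs based in \<open>X\<close> with periods at most \<open>w\<close> apart and base points at most \<open>r\<close> apart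
  cannot stay \<open>e\<close>-close unless they have the same period and lie on the same orbit; in that case they
  are even \<open>e/2\<close>-close for all times. The gain of the factor \<open>1/2\<close> makes it possible to repeat
  gluing constructions without losing precision.\<close>

definition expansive_at :: "'a set \<Rightarrow> real \<Rightarrow> real \<Rightarrow> real \<Rightarrow> bool" where
  "expansive_at X e w r \<longleftrightarrow>
    (\<forall>x\<in>X. \<forall>x'\<in>X. \<forall>T>0. \<forall>T'>0. \<phi> T x = x \<longrightarrow> \<phi> T' x' = x' \<longrightarrow> \<bar>T - T'\<bar> \<le> w \<longrightarrow> dist x x' \<le> r \<longrightarrow>
      (\<forall>s\<in>{0..min T T'}. dist (\<phi> s x) (\<phi> s x') \<le> e) \<longrightarrow>
      T = T' \<and> (\<exists>u. x' = \<phi> u x) \<and> (\<forall>s. dist (\<phi> s x) (\<phi> s x') \<le> e / 2))"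

text \<open>The two arcs are compared through the linear change of time matching their periods.\<close>

lemma close_arcs_same_orbit:
  assumes B: "B > 0" "\<And>x t. dist x (\<phi> t x) \<le> B * \<bar>t\<bar>"
    and exp: "\<forall>x y. (\<exists>s :: real \<Rightarrow> real. continuous_on UNIV s \<and> s 0 = 0 \<and>
      (\<forall>t. dist (\<phi> t x) (\<phi> (s t) y) \<le> \<epsilon>)) \<longrightarrow> (\<exists>\<tau>\<in>{-\<nu>..\<nu>}. y = \<phi> \<tau> x)"
    and per: "\<phi> T x = x" "\<phi> T' x' = x'" "0 < T" "T \<le> T'" "T' - T \<le> \<epsilon> / (2 * B)"
    and close: "\<And>s. s \<in> {0..T} \<Longrightarrow> dist (\<phi> s x) (\<phi> s x') \<le> \<epsilon> / 2"
  shows "\<exists>u\<in>{-\<nu>..\<nu>}. x' = \<phi> u x"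
proof (rule exp[rule_format], intro exI[of _ "\<lambda>t. T' / T * t"] conjI allI)
  fix t
  define n where "n = \<lfloor>t / T\<rfloor>"
  define t0 where "t0 = t - of_int n * T"
  have t0: "0 \<le> t0" "t0 < T" using mod_period_bounds[OF per(3), of t] by (auto simp: t0_def n_def)
  have "\<phi> t x = \<phi> t0 x" using flow_mod_period[OF per(1,3), of t] by (simp add: t0_def n_def)
  moreover have "\<phi> (T' / T * t) x' = \<phi> ((T' / T - 1) * t0) (\<phi> t0 x')"
  proof -
    have "T' / T * t = ((T' / T - 1) * t0 + t0) + of_int n * T'"
      using per(3) by (simp add: t0_def field_simps)
    then have "\<phi> (T' / T * t) x' = \<phi> ((T' / T - 1) * t0 + t0) x'"
      using flow_int_multiple[OF per(2), of n] by (simp add: flow_add)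
    then show ?thesis by (simp only: flow_add)
  qed
  moreover have "dist (\<phi> t0 x') (\<phi> ((T' / T - 1) * t0) (\<phi> t0 x')) \<le> \<epsilon> / 2"
  proof -
    have "(T' / T - 1) * t0 = (T' - T) * (t0 / T)" using per(3) by (simp add: field_simps)
    moreover have "0 \<le> (T' - T) * (t0 / T)" using per(3,4) t0 by simp
    ultimately have "\<bar>(T' / T - 1) * t0\<bar> = (T' - T) * (t0 / T)" by (metis abs_of_nonneg)
    also have "\<dots> \<le> (T' - T) * 1" using t0 per by (intro mult_left_mono) auto
    also have "\<dots> \<le> \<epsilon> / (2 * B)" using per(5) by simp
    finally have "B * \<bar>(T' / T - 1) * t0\<bar> \<le> B * (\<epsilon> / (2 * B))" using B(1) by (intro mult_left_mono) auto
    also have "\<dots> = \<epsilon> / 2" using B(1) by simp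
    finally show ?thesis using B(2)[of "\<phi> t0 x'" "(T' / T - 1) * t0"] by linarith
  qed
  moreover have "dist (\<phi> t0 x) (\<phi> t0 x') \<le> \<epsilon> / 2" using close t0 by simp
  moreover have "dist (\<phi> t0 x) (\<phi> ((T' / T - 1) * t0) (\<phi> t0 x')) \<le>
      dist (\<phi> t0 x) (\<phi> t0 x') + dist (\<phi> t0 x') (\<phi> ((T' / T - 1) * t0) (\<phi> t0 x'))"
    by (rule dist_triangle)
  ultimately show "dist (\<phi> t x) (\<phi> (T' / T * t) x') \<le> \<epsilon>" by simp
qed (use per(3) in \<open>auto intro!: continuous_intros\<close>)

lemma expansive_scale:
  assumes "compact X"
  obtains e w r where "0 < e" "0 < w" "w \<le> 1" "0 < r" "expansive_at X e w r"
proof -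
  obtain \<kappa> where \<kappa>: "\<kappa> > 0" "\<And>x t. x \<in> X \<Longrightarrow> \<phi> t x = x \<Longrightarrow> \<bar>t\<bar> \<le> \<kappa> \<Longrightarrow> t = 0"
    using no_short_periods[OF assms] by metis
  obtain B where B: "B > 0" "\<And>x t. dist x (\<phi> t x) \<le> B * \<bar>t\<bar>" using displacement_bound by metis
  obtain \<epsilon> where \<epsilon>: "\<epsilon> > 0" "\<forall>x y. (\<exists>s :: real \<Rightarrow> real. continuous_on UNIV s \<and> s 0 = 0 \<and>
      (\<forall>t. dist (\<phi> t x) (\<phi> (s t) y) \<le> \<epsilon>)) \<longrightarrow> (\<exists>\<tau>\<in>{-\<kappa>..\<kappa>}. y = \<phi> \<tau> x)"
    using expansive[OF \<kappa>(1)] by metis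
  \<comment> \<open>The other half of the expansivity constant absorbs the change of time, which moves points by at
    most \<open>B * w\<close>.\<close>
  define e where "e = \<epsilon> / 2"
  define w where "w = min 1 (min \<kappa> (\<epsilon> / (2 * B)))"
  define \<nu> where "\<nu> = min \<kappa> (e / (2 * B))"
  have pos: "e > 0" "w > 0" "\<nu> > 0" using \<epsilon>(1) \<kappa>(1) B(1) by (auto simp: e_def w_def \<nu>_def)
  \<comment> \<open>Expansivity yields a time shift in \<open>[-\<kappa>, \<kappa>]\<close>. The shift is in fact smaller than \<open>\<nu>\<close>, since
    points of \<open>X\<close> have no period in \<open>(0, \<kappa>]\<close> and hence a shift between \<open>\<nu>\<close> and \<open>\<kappa>\<close> moves them by at
    least some \<open>m > 0\<close>.\<close>
  define S where "S = X \<times> ({-\<kappa>..\<kappa>} - {-\<nu><..<\<nu>})"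
  have "compact S" unfolding S_def using assms by (intro compact_Times compact_diff) auto
  have "\<exists>m>0. \<forall>(x, u)\<in>S. m \<le> dist x (\<phi> u x)"
  proof (cases "S = {}")
    case True then show ?thesis by (intro exI[of _ 1]) auto
  next
    case False
    have "continuous_on S (\<lambda>z. dist (fst z) ((\<lambda>(t, x). \<phi> t x) (snd z, fst z)))"
      by (intro continuous_intros continuous_on_compose2[OF flow_continuous]) auto
    then obtain z where z: "z \<in> S" "\<forall>y\<in>S. dist (fst z) (\<phi> (snd z) (fst z)) \<le> dist (fst y) (\<phi> (snd y) (fst y))"
      using continuous_attains_inf[OF \<open>compact S\<close> False] by fastforce
    have "dist (fst z) (\<phi> (snd z) (fst z)) > 0"
    proof (rule ccontr)
      assume "\<not> ?thesis"
      then have "\<phi> (snd z) (fst z) = fst z" by simp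
      then have "snd z = 0" using z(1) \<kappa>(2)[of "fst z" "snd z"] by (auto simp: S_def)
      then show False using z(1) pos by (auto simp: S_def)
    qed
    then show ?thesis using z(2) by (intro exI[of _ "dist (fst z) (\<phi> (snd z) (fst z))"]) auto
  qed
  then obtain m where m: "m > 0" "\<And>x u. (x, u) \<in> S \<Longrightarrow> m \<le> dist x (\<phi> u x)" by blast
  have "expansive_at X e w (m / 2)"
    unfolding expansive_at_def
  proof (intro ballI allI impI)
    fix x x' T T'
    assume x: "x \<in> X" "x' \<in> X" and T: "0 < T" "0 < T'" and per: "\<phi> T x = x" "\<phi> T' x' = x'"
      and w: "\<bar>T - T'\<bar> \<le> w" and r: "dist x x' \<le> m / 2"
      and close: "\<forall>s\<in>{0..min T T'}. dist (\<phi> s x) (\<phi> s x') \<le> e"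
    have wB: "w \<le> \<epsilon> / (2 * B)" "w \<le> \<kappa>" by (auto simp: w_def)
    have "\<exists>u\<in>{-\<kappa>..\<kappa>}. x' = \<phi> u x"
    proof (cases "T \<le> T'")
      case True
      show ?thesis
        by (rule close_arcs_same_orbit[OF B \<epsilon>(2) per T(1) True]) (use close w wB True in \<open>auto simp: e_def\<close>)
    next
      case False
      have "\<exists>u\<in>{-\<kappa>..\<kappa>}. x = \<phi> u x'"
        by (rule close_arcs_same_orbit[OF B \<epsilon>(2) per(2,1) T(2)])
          (use close w wB False in \<open>auto simp: e_def dist_commute\<close>)
      then obtain u where u: "u \<in> {-\<kappa>..\<kappa>}" "x = \<phi> u x'" by blast
      then have "x' = \<phi> (- u) x" by (simp flip: flow_add)
      then show ?thesis using u(1) by (intro bexI[of _ "- u"]) auto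
    qed
    then obtain u where u: "u \<in> {-\<kappa>..\<kappa>}" "x' = \<phi> u x" by blast
    have "\<phi> (- u) (\<phi> T' (\<phi> u x)) = \<phi> (- u) (\<phi> u x)" using per(2) u(2) by simp
    then have "\<phi> T' x = x" by (simp flip: flow_add)
    then have "\<phi> (T' - T) x = x" using flow_add[of "T' - T" T x] per(1) by simp
    then have "T' - T = 0" by (rule \<kappa>(2)[OF x(1)]) (use w wB in auto)
    moreover have "dist (\<phi> s x) (\<phi> s x') \<le> e / 2" for s
    proof -
      have "\<bar>u\<bar> < \<nu>"
      proof (rule ccontr)
        assume "\<not> ?thesis"
        then have "(x, u) \<in> S" using u(1) x(1) by (auto simp: S_def)
        then show False using m r u(2) by fastforce
      qed
      then have "B * \<bar>u\<bar> \<le> B * (e / (2 * B))" using B(1) by (intro mult_left_mono) (auto simp: \<nu>_def)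
      moreover have "dist (\<phi> s x) (\<phi> s x') \<le> B * \<bar>u\<bar>"
        using B(2)[of "\<phi> s x" u] by (simp add: u(2) flow_commute)
      ultimately show ?thesis using B(1) by simp
    qed
    ultimately show "T = T' \<and> (\<exists>u. x' = \<phi> u x) \<and> (\<forall>s. dist (\<phi> s x) (\<phi> s x') \<le> e / 2)"
      using u(2) by auto
  qed
  then show thesis using that[of e w "m / 2"] pos m(1) by (simp add: w_def)
qed

text \<open>A closed arc is a base point with a return time; unlike a period, the return time may be \<open>0\<close>.\<close>

definition closed_arcs :: "'a set \<Rightarrow> ('a \<times> real) set" where
  "closed_arcs X = {a. fst a \<in> X \<and> 0 \<le> snd a \<and> \<phi> (snd a) (fst a) = fst a}"

text \<open>Distinct arcs of the family are told apart by the flow at precision \<open>e\<close> before the shorter of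
  the two return times.\<close>

definition separated :: "real \<Rightarrow> ('a \<times> real) set \<Rightarrow> bool" where
  "separated e E \<longleftrightarrow> (\<forall>a\<in>E. \<forall>b\<in>E. a \<noteq> b \<longrightarrow>
     (\<exists>s\<in>{0..min (snd a) (snd b)}. e < dist (\<phi> s (fst a)) (\<phi> s (fst b))))"

lemma separatedD:
  assumes "separated e E" "a \<in> E" "b \<in> E"
    "\<And>s. s \<in> {0..min (snd a) (snd b)} \<Longrightarrow> dist (\<phi> s (fst a)) (\<phi> s (fst b)) \<le> e"
  shows "a = b"
  using assms unfolding separated_def by (meson not_le)

end

section \<open>Gluing closed arcs\<close>

text \<open>Any two closed arcs \<open>a\<close>, \<open>b\<close> based in \<open>X\<close> can be followed one after the other by a periodic orbit
  \<open>G a b\<close> starting close to \<open>p\<close>. The transition times \<open>c1\<close>, \<open>c2\<close>, \<open>c3\<close> before, between and after the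
  two arcs depend on the base points only, not on the lengths of the arcs, and take values in the
  finite set \<open>F\<close>. They are at least \<open>1 + \<epsilon>\<close>, so that glued orbits have period at least \<open>1\<close>, whatever
  the return times of \<open>a\<close> and \<open>b\<close> are.\<close>

locale orbit_gluing = H_flow A g \<phi>
  for A :: "('a::metric_space, 'e::euclidean_space) chart set" and g and \<phi> +
  fixes X :: "'a set" and p :: 'a and \<epsilon> :: real and F :: "real set"
    and c1 c2 c3 :: "'a \<Rightarrow> 'a \<Rightarrow> real" and G :: "'a \<times> real \<Rightarrow> 'a \<times> real \<Rightarrow> 'a \<times> real"
  assumes eps_pos: "\<epsilon> > 0" and finite_F: "finite F"
    and times_F: "x \<in> X \<Longrightarrow> y \<in> X \<Longrightarrow> c1 x y \<in> F \<and> c2 x y \<in> F \<and> c3 x y \<in> F"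
    and F_lower: "c \<in> F \<Longrightarrow> 1 + \<epsilon> \<le> c"
    and glued: "a \<in> closed_arcs X \<Longrightarrow> b \<in> closed_arcs X \<Longrightarrow>
      fst (G a b) \<in> ball p (2 * \<epsilon>) \<and>
      \<phi> (snd (G a b)) (fst (G a b)) = fst (G a b) \<and>
      \<bar>snd (G a b) -
        (c1 (fst a) (fst b) + snd a + c2 (fst a) (fst b) + snd b + c3 (fst a) (fst b))\<bar> \<le> \<epsilon> \<and>
      (\<forall>s\<in>{0..snd a}. dist (\<phi> (c1 (fst a) (fst b) + s) (fst (G a b))) (\<phi> s (fst a)) \<le> 2 * \<epsilon>) \<and>
      (\<forall>s\<in>{0..snd b}.
        dist (\<phi> (c1 (fst a) (fst b) + snd a + c2 (fst a) (fst b) + s) (fst (G a b))) (\<phi> s (fst b)) \<le> 2 * \<epsilon>)"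

text \<open>Cover \<open>X\<close> by finitely many cells; transitivity provides transition arcs between \<open>p\<close> and the cells.
  A closed arc starts and ends in the same cell, so
  transition, first arc, transition, second arc, transition form a pseudo-orbit with five pieces which
  starts and ends near \<open>p\<close>. It is shadowed, and the shadowing orbit is closed up at \<open>p\<close>.\<close>

lemma (in H_flow) orbit_gluing_exists:
  assumes X: "compact X" and \<epsilon>: "\<epsilon> > 0"
  shows "\<exists>F c1 c2 c3 G. orbit_gluing A g \<phi> X p \<epsilon> F c1 c2 c3 G"
proof -
  obtain \<delta>c Tmin where \<delta>c: "\<delta>c > 0" "Tmin > 0" and
    closing: "\<And>y t. y \<in> ball p \<epsilon> \<Longrightarrow> t \<ge> Tmin \<Longrightarrow> dist (\<phi> t y) y \<le> \<delta>c \<Longrightarrow>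
      \<exists>z\<in>ball y \<epsilon>. \<exists>\<tau>\<in>{t - \<epsilon>..t + \<epsilon>}. \<phi> \<tau> z = z \<and> (\<forall>s\<in>{0..t}. dist (\<phi> s z) (\<phi> s y) \<le> \<epsilon>)"
    using closing_lemma[OF \<epsilon>, of p] by metis
  have cX: "compact (insert p X)" using X by simp
  obtain U C where UC: "open U" "compact C" "insert p X \<subseteq> U" "U \<subseteq> C"
    using compact_neighbourhood[OF cX] by blast
  define \<delta> where "\<delta> = min (\<epsilon> / 2) (\<delta>c / 4)"
  have \<delta>: "\<delta> > 0" "\<delta> \<le> \<epsilon> / 2" "\<delta> \<le> \<delta>c / 4" using \<epsilon> \<delta>c by (auto simp: \<delta>_def)
  obtain \<eta> where \<eta>: "\<eta> > 0" and
    shadow: "\<And>(x :: nat \<Rightarrow> 'a) (t :: nat \<Rightarrow> real). (\<forall>i\<in>{1..5}. x i \<in> C \<and> t i \<ge> 0) \<Longrightarrow>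
      (\<forall>i. 1 \<le> i \<and> i < 5 \<longrightarrow> dist (\<phi> (t i) (x i)) (x (i + 1)) < \<eta>) \<Longrightarrow>
      (\<exists>y. \<forall>i\<in>{1..5}. \<forall>s\<in>{0..t i}. dist (\<phi> (s + (\<Sum>j\<in>{1..<i}. t j)) y) (\<phi> s (x i)) < \<delta>)"
    using finite_exact_shadowing[OF UC(2) \<delta>(1), of 5] by (metis one_le_numeral)
  obtain r0 where r0: "r0 > 0" "(\<Union>x\<in>insert p X. ball x r0) \<subseteq> U"
    using compact_subset_open_imp_ball_epsilon_subset[OF cX UC(1) UC(3)] by blast
  \<comment> \<open>The ends of consecutive pieces are within \<open>r\<close> of each other, and the shadowing orbit returns to
    its starting point up to \<open>2 * \<delta> + r\<close>, which is below the threshold of the closing lemma.\<close>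
  define r where "r = min (min \<eta> (\<epsilon> / 2)) (min (\<delta>c / 4) r0)"
  have r: "r > 0" "r \<le> \<eta>" "r \<le> \<epsilon> / 2" "r \<le> \<delta>c / 4" "r \<le> r0"
    using \<eta> \<epsilon> \<delta>c r0 by (auto simp: r_def)
  obtain k cell where k: "finite k" "k \<subseteq> X" "\<And>x. x \<in> X \<Longrightarrow> cell x \<in> k \<and> dist (cell x) x < r / 2"
    using compact_cells[OF X, of "r / 2"] r(1) by auto
  have "\<exists>q t. dist a q < r / 2 \<and> Tmin + 1 + \<epsilon> \<le> t \<and> dist b (\<phi> t q) < r / 2" for a b
    using transitive[of "ball a (r / 2)" "ball b (r / 2)" "Tmin + 1 + \<epsilon>"] r(1) \<epsilon> \<delta>c(2) by fastforce
  then obtain q t where qt: "\<And>a b. dist a (q a b) < r / 2" "\<And>a b. Tmin + 1 + \<epsilon> \<le> t a b"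
    "\<And>a b. dist b (\<phi> (t a b) (q a b)) < r / 2"
    by metis
  have qC: "q a b \<in> C" if "a \<in> insert p X" for a b
  proof -
    have "q a b \<in> ball a r0" using qt(1)[of a b] r by simp
    then show ?thesis using that r0(2) UC(4) by blast
  qed
  have near: "dist x y < \<eta>" if "dist a x < r / 2" "dist a y < r / 2" for a x y
    using that r(2) dist_triangle3[of x y a] by linarith
  define F where "F = (\<lambda>(a, b). t a b) ` (insert p k \<times> insert p k)"
  define c1 where "c1 = (\<lambda>(x :: 'a) (y :: 'a). t p (cell x))"
  define c2 where "c2 = (\<lambda>x y. t (cell x) (cell y))"
  define c3 where "c3 = (\<lambda>(x :: 'a) (y :: 'a). t (cell y) p)"
  define Q where "Q = (\<lambda>(a :: 'a \<times> real) (b :: 'a \<times> real) (v :: 'a \<times> real).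
    fst v \<in> ball p (2 * \<epsilon>) \<and> \<phi> (snd v) (fst v) = fst v \<and>
      \<bar>snd v - (c1 (fst a) (fst b) + snd a + c2 (fst a) (fst b) + snd b + c3 (fst a) (fst b))\<bar> \<le> \<epsilon> \<and>
      (\<forall>s\<in>{0..snd a}. dist (\<phi> (c1 (fst a) (fst b) + s) (fst v)) (\<phi> s (fst a)) \<le> 2 * \<epsilon>) \<and>
      (\<forall>s\<in>{0..snd b}.
        dist (\<phi> (c1 (fst a) (fst b) + snd a + c2 (fst a) (fst b) + s) (fst v)) (\<phi> s (fst b)) \<le> 2 * \<epsilon>))"
  have "\<exists>v. Q a b v" if ab: "a \<in> closed_arcs X" "b \<in> closed_arcs X" for a b
  proof -
    define x1 where "x1 = fst a"
    define x2 where "x2 = fst b"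
    define T1 where "T1 = snd a"
    define T2 where "T2 = snd b"
    have arcs: "x1 \<in> X" "x2 \<in> X" "T1 \<ge> 0" "T2 \<ge> 0" "\<phi> T1 x1 = x1" "\<phi> T2 x2 = x2"
      using ab by (auto simp: closed_arcs_def x1_def x2_def T1_def T2_def)
    define u1 where "u1 = t p (cell x1)"
    define u2 where "u2 = t (cell x1) (cell x2)"
    define u3 where "u3 = t (cell x2) p"
    have u: "u1 \<ge> Tmin" "u2 \<ge> 0" "u3 \<ge> 0" using qt(2) \<epsilon> \<delta>c(2)
      by (smt (verit) u1_def u2_def u3_def)+
    define x where "x = (\<lambda>i::nat. if i = 1 then q p (cell x1) else if i = 2 then x1
      else if i = 3 then q (cell x1) (cell x2) else if i = 4 then x2 else q (cell x2) p)"
    define d where "d = (\<lambda>i::nat. if i = 1 then u1 else if i = 2 then T1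
      else if i = 3 then u2 else if i = 4 then T2 else u3)"
    have range5: "i \<in> {1..5} \<longleftrightarrow> i = 1 \<or> i = 2 \<or> i = 3 \<or> i = 4 \<or> i = 5" for i :: nat by auto
    have range4: "1 \<le> i \<and> i < 5 \<longleftrightarrow> i = 1 \<or> i = 2 \<or> i = 3 \<or> i = 4" for i :: nat by auto
    have cells: "cell x1 \<in> X" "cell x2 \<in> X" "dist (cell x1) x1 < r / 2" "dist (cell x2) x2 < r / 2"
      using k arcs by auto
    have XC: "X \<subseteq> C" using UC by blast
    have "\<forall>i\<in>{1..5}. x i \<in> C \<and> d i \<ge> 0"
      unfolding range5 x_def d_def Ball_def using qC cells arcs u \<delta>c(2) XC by auto
    moreover have "\<forall>i. 1 \<le> i \<and> i < 5 \<longrightarrow> dist (\<phi> (d i) (x i)) (x (i + 1)) < \<eta>"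
      unfolding range4 x_def d_def u1_def u2_def u3_def
      using near[OF qt(3) cells(3)] near[OF cells(3) qt(1)] near[OF qt(3) cells(4)]
        near[OF cells(4) qt(1)] arcs by auto
    ultimately obtain y where
      y: "\<forall>i\<in>{1..5}. \<forall>s\<in>{0..d i}. dist (\<phi> (s + (\<Sum>j\<in>{1..<i}. d j)) y) (\<phi> s (x i)) < \<delta>"
      using shadow by blast
    have sums: "(\<Sum>j\<in>{1..<2}. d j) = u1" "(\<Sum>j\<in>{1..<4}. d j) = u1 + T1 + u2"
      "(\<Sum>j\<in>{1..<5}. d j) = u1 + T1 + u2 + T2"
      unfolding sum_pieces by (simp_all add: d_def)
    have y1: "dist y (q p (cell x1)) < \<delta>"
      using y[rule_format, of 1 0] u \<delta>c(2) by (auto simp: x_def d_def)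
    have y2: "dist (\<phi> (u1 + s) y) (\<phi> s x1) < \<delta>" if "s \<in> {0..T1}" for s
      using y[rule_format, of 2 s] that unfolding sums by (auto simp: x_def d_def add.commute)
    have y4: "dist (\<phi> (u1 + T1 + u2 + s) y) (\<phi> s x2) < \<delta>" if "s \<in> {0..T2}" for s
      using y[rule_format, of 4 s] that unfolding sums by (auto simp: x_def d_def algebra_simps)
    define T where "T = u1 + T1 + u2 + T2 + u3"
    have y5: "dist (\<phi> T y) (\<phi> u3 (q (cell x2) p)) < \<delta>"
      using y[rule_format, of 5 u3] u unfolding sums by (auto simp: x_def d_def T_def algebra_simps)
    have "dist p y < r / 2 + \<delta>"
      using y1 qt(1)[of p "cell x1"] dist_triangle2[of p y "q p (cell x1)"] by linarith
    moreover have "dist p (\<phi> T y) < r / 2 + \<delta>"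
      using y5 qt(3)[of p "cell x2"] dist_triangle2[of p "\<phi> T y" "\<phi> u3 (q (cell x2) p)"]
      unfolding u3_def by linarith
    ultimately have "y \<in> ball p \<epsilon>" "dist (\<phi> T y) y \<le> \<delta>c"
      using r \<delta> dist_triangle3[of "\<phi> T y" y p] by (auto simp del: dist_triangle3)
    moreover have "T \<ge> Tmin" using u arcs by (simp add: T_def)
    ultimately obtain z \<tau> where z: "z \<in> ball y \<epsilon>" "\<tau> \<in> {T - \<epsilon>..T + \<epsilon>}" "\<phi> \<tau> z = z"
      "\<forall>s\<in>{0..T}. dist (\<phi> s z) (\<phi> s y) \<le> \<epsilon>"
      using closing by blast
    have "dist p z < 2 * \<epsilon>"
      using z(1) \<open>y \<in> ball p \<epsilon>\<close> dist_triangle[of p z y] by simp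
    moreover have "dist (\<phi> (u1 + s) z) (\<phi> s x1) \<le> 2 * \<epsilon>" if "s \<in> {0..T1}" for s
    proof -
      have "u1 + s \<in> {0..T}" using that u arcs \<delta>c(2) by (auto simp: T_def)
      then show ?thesis
        using z(4) y2[OF that] dist_triangle[of "\<phi> (u1 + s) z" "\<phi> s x1" "\<phi> (u1 + s) y"] \<delta> \<epsilon> by fastforce
    qed
    moreover have "dist (\<phi> (u1 + T1 + u2 + s) z) (\<phi> s x2) \<le> 2 * \<epsilon>" if "s \<in> {0..T2}" for s
    proof -
      have "u1 + T1 + u2 + s \<in> {0..T}" using that u arcs \<delta>c(2) by (auto simp: T_def)
      then show ?thesis
        using z(4) y4[OF that] \<delta> \<epsilon>
          dist_triangle[of "\<phi> (u1 + T1 + u2 + s) z" "\<phi> s x2" "\<phi> (u1 + T1 + u2 + s) y"] by fastforce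
    qed
    moreover have "\<bar>\<tau> - (u1 + T1 + u2 + T2 + u3)\<bar> \<le> \<epsilon>" using z(2) by (auto simp: T_def)
    ultimately have "Q a b (z, \<tau>)"
      using z(3)
      by (simp add: Q_def c1_def c2_def c3_def x1_def x2_def T1_def T2_def u1_def u2_def u3_def)
    then show ?thesis ..
  qed
  then obtain G where G: "\<And>a b. a \<in> closed_arcs X \<Longrightarrow> b \<in> closed_arcs X \<Longrightarrow> Q a b (G a b)"
    by metis
  have "orbit_gluing A g \<phi> X p \<epsilon> F c1 c2 c3 G"
  proof
    show "finite F" using k(1) by (simp add: F_def)
    show "c1 x y \<in> F \<and> c2 x y \<in> F \<and> c3 x y \<in> F" if "x \<in> X" "y \<in> X" for x y
      using k(3)[OF that(1)] k(3)[OF that(2)] by (auto simp: F_def c1_def c2_def c3_def)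
    show "1 + \<epsilon> \<le> c" if c: "c \<in> F" for c
    proof -
      obtain a b where "c = t a b" using c by (auto simp: F_def)
      then show ?thesis using qt(2)[of a b] \<delta>c(2) by linarith
    qed
  qed (use \<epsilon> G in \<open>auto simp: Q_def\<close>)
  then show ?thesis by blast
qed

context orbit_gluing
begin

text \<open>Arcs of a separated family are determined by the glued orbit, if the transition times are known:
  each arc is followed up to \<open>2 * \<epsilon>\<close>. The position of the second arc in the glued orbit also depends on
  the return time of the first one, which is why the first arc is identified first.\<close>

lemma glued_first_eq:
  assumes E: "E \<subseteq> closed_arcs X" "separated e E" "a \<in> E" "a' \<in> E"
    and b: "b \<in> closed_arcs X" "b' \<in> closed_arcs X"
    and e: "4 * \<epsilon> + d \<le> e"
    and c1: "c1 (fst a) (fst b) = c1 (fst a') (fst b')"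
    and close: "\<And>s. dist (\<phi> s (fst (G a b))) (\<phi> s (fst (G a' b'))) \<le> d"
  shows "a = a'"
proof (rule separatedD[OF E(2-4)])
  fix s assume s: "s \<in> {0..min (snd a) (snd a')}"
  let ?t = "c1 (fst a) (fst b) + s"
  have "dist (\<phi> ?t (fst (G a b))) (\<phi> s (fst a)) \<le> 2 * \<epsilon>"
    using glued[of a b] E b s by auto
  moreover have "dist (\<phi> ?t (fst (G a' b'))) (\<phi> s (fst a')) \<le> 2 * \<epsilon>"
    using glued[of a' b'] E b s c1 by auto
  moreover note close[of ?t]
  ultimately show "dist (\<phi> s (fst a)) (\<phi> s (fst a')) \<le> e"
    using e dist_triangle3[of "\<phi> s (fst a)" "\<phi> s (fst a')" "\<phi> ?t (fst (G a b))"]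
      dist_triangle[of "\<phi> ?t (fst (G a b))" "\<phi> s (fst a')" "\<phi> ?t (fst (G a' b'))"] by linarith
qed

lemma glued_second_eq:
  assumes E: "E \<subseteq> closed_arcs X" "separated e E" "b \<in> E" "b' \<in> E"
    and a: "a \<in> closed_arcs X"
    and e: "4 * \<epsilon> + d \<le> e"
    and c: "c1 (fst a) (fst b) = c1 (fst a) (fst b')" "c2 (fst a) (fst b) = c2 (fst a) (fst b')"
    and close: "\<And>s. dist (\<phi> s (fst (G a b))) (\<phi> s (fst (G a b'))) \<le> d"
  shows "b = b'"
proof (rule separatedD[OF E(2-4)])
  fix s assume s: "s \<in> {0..min (snd b) (snd b')}"
  let ?t = "c1 (fst a) (fst b) + snd a + c2 (fst a) (fst b) + s"
  have "dist (\<phi> ?t (fst (G a b))) (\<phi> s (fst b)) \<le> 2 * \<epsilon>"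
    using glued[of a b] E a s by auto
  moreover have "dist (\<phi> ?t (fst (G a b'))) (\<phi> s (fst b')) \<le> 2 * \<epsilon>"
    using glued[of a b'] E a s c by auto
  moreover note close[of ?t]
  ultimately show "dist (\<phi> s (fst b)) (\<phi> s (fst b')) \<le> e"
    using e dist_triangle3[of "\<phi> s (fst b)" "\<phi> s (fst b')" "\<phi> ?t (fst (G a b))"]
      dist_triangle[of "\<phi> ?t (fst (G a b))" "\<phi> s (fst b')" "\<phi> ?t (fst (G a b'))"] by linarith
qed

lemma transition_bound: obtains C where "C \<ge> 0" "\<And>c. c \<in> F \<Longrightarrow> c \<le> C"
proof -
  obtain C where "\<And>c. c \<in> F \<Longrightarrow> c \<le> C"
    using finite_F by (meson Max_ge)
  then show thesis by (intro that[of "max C 0"]) (auto simp: le_max_iff_disj)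
qed

lemma glued_period:
  assumes "a \<in> closed_arcs X" "b \<in> closed_arcs X" "\<And>c. c \<in> F \<Longrightarrow> c \<le> C"
  shows "snd a + snd b + 1 \<le> snd (G a b)" "snd (G a b) \<le> snd a + snd b + (3 * C + \<epsilon>)"
proof -
  have X: "fst a \<in> X" "fst b \<in> X" using assms by (auto simp: closed_arcs_def)
  note t = times_F[OF X]
  have "1 + \<epsilon> \<le> c1 (fst a) (fst b)" "1 + \<epsilon> \<le> c2 (fst a) (fst b)" "1 + \<epsilon> \<le> c3 (fst a) (fst b)"
    "c1 (fst a) (fst b) \<le> C" "c2 (fst a) (fst b) \<le> C" "c3 (fst a) (fst b) \<le> C"
    using F_lower assms(3) t by auto
  moreover have "\<bar>snd (G a b) -
      (c1 (fst a) (fst b) + snd a + c2 (fst a) (fst b) + snd b + c3 (fst a) (fst b))\<bar> \<le> \<epsilon>"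
    using glued[OF assms(1,2)] by blast
  ultimately show "snd a + snd b + 1 \<le> snd (G a b)" "snd (G a b) \<le> snd a + snd b + (3 * C + \<epsilon>)"
    using eps_pos by linarith+
qed

end

section \<open>From closed arcs to periodic orbits and back\<close>

text \<open>Finite separated families of closed arcs with return times in \<open>[L, L + w]\<close>. Their cardinality
  plays the role of the number of periodic orbits, except that the same orbit may occur with several
  base points.\<close>

definition (in H_flow) arc_family :: "'a set \<Rightarrow> real \<Rightarrow> real \<Rightarrow> real \<Rightarrow> ('a \<times> real) set \<Rightarrow> bool" where
  "arc_family X e w L E \<longleftrightarrow> finite E \<and> E \<subseteq> closed_arcs X \<and> separated e E \<and>
     (\<forall>a\<in>E. L \<le> snd a \<and> snd a \<le> L + w)"

context H_flow
begin

text \<open>The orbit of a point.\<close>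

definition orb :: "'a \<Rightarrow> 'a set" where
  "orb x = range (\<lambda>t. \<phi> t x)"

lemma orb_self: "x \<in> orb x"
  unfolding orb_def using flow_0[of x] by (metis rangeI)

lemma orb_flow: "orb (\<phi> u x) = orb x"
proof -
  have "\<phi> t (\<phi> u x) \<in> orb x" for t by (simp add: orb_def flip: flow_add)
  moreover have "\<phi> t x \<in> orb (\<phi> u x)" for t
  proof -
    have "\<phi> t x = \<phi> (t - u) (\<phi> u x)" by (simp flip: flow_add)
    then show ?thesis unfolding orb_def by blast
  qed
  ultimately show ?thesis unfolding orb_def by blast
qed

lemma orbits_meetingE:
  assumes "\<gamma> \<in> orbits_meeting \<phi> K T0 T1"
  obtains x where "x \<in> K" "fst \<gamma> = orb x" "\<phi> (snd \<gamma>) x = x" "snd \<gamma> > 0" "T0 \<le> snd \<gamma>" "snd \<gamma> \<le> T1"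
proof -
  obtain y T where yT: "\<gamma> = (orb y, T)" "T > 0" "\<phi> T y = y" "T0 \<le> T" "T \<le> T1" "orb y \<inter> K \<noteq> {}"
    using assms unfolding orbits_meeting_def periodic_orbits_def orb_def by fastforce
  then obtain u where u: "\<phi> u y \<in> K" unfolding orb_def by blast
  show thesis
  proof (rule that[of "\<phi> u y"])
    show "fst \<gamma> = orb (\<phi> u y)" unfolding orb_flow by (simp add: yT(1))
    show "\<phi> (snd \<gamma>) (\<phi> u y) = \<phi> u y" using yT by (simp add: flow_commute[of T])
  qed (use yT u in auto)
qed

lemma orbits_meetingI:
  assumes "x \<in> K" "\<phi> T x = x" "T > 0" "T0 \<le> T" "T \<le> T1"
  shows "(orb x, T) \<in> orbits_meeting \<phi> K T0 T1"
  using assms orb_self[of x] unfolding orbits_meeting_def periodic_orbits_def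
  by (auto simp flip: orb_def)

text \<open>A periodic orbit of period about \<open>L\<close> carries at most \<open>O(L)\<close> mutually separated base points, since
  points at flow time less than \<open>e / B\<close> from each other stay \<open>e\<close>-close forever. The set \<open>I\<close> labels
  base points and periods \<open>z i\<close>.\<close>

lemma orbits_of_separated:
  assumes "e > 0" "\<sigma> \<ge> 0"
  shows "\<exists>D>0. \<forall>L\<ge>1. \<forall>(I :: ('a \<times> real) set) z. finite I \<longrightarrow>
    (\<forall>i\<in>I. fst (z i) \<in> K \<and> \<phi> (snd (z i)) (fst (z i)) = fst (z i) \<and>
      L \<le> snd (z i) \<and> snd (z i) \<le> L + \<sigma>) \<longrightarrow>
    (\<forall>i\<in>I. \<forall>j\<in>I. (\<forall>s. dist (\<phi> s (fst (z i))) (\<phi> s (fst (z j))) \<le> e) \<longrightarrow> i = j) \<longrightarrow>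
    (\<exists>\<Gamma>. finite \<Gamma> \<and> \<Gamma> \<subseteq> orbits_meeting \<phi> K L (L + \<sigma>) \<and> real (card I) \<le> D * L * real (card \<Gamma>))"
proof -
  obtain B where B: "B > 0" "\<And>x t. dist x (\<phi> t x) \<le> B * \<bar>t\<bar>" using displacement_bound by metis
  define \<nu> where "\<nu> = e / B"
  have \<nu>: "\<nu> > 0" using B(1) assms by (simp add: \<nu>_def)
  define D where "D = (1 + \<sigma>) / \<nu> + 1"
  have D: "D > 0" using \<nu> assms by (simp add: D_def add_nonneg_pos)
  show ?thesis
  proof (intro exI[of _ D] conjI allI impI D)
    fix L :: real and I :: "('a \<times> real) set" and z :: "'a \<times> real \<Rightarrow> 'a \<times> real"
    assume L: "1 \<le> L" and I: "finite I"
      and z: "\<forall>i\<in>I. fst (z i) \<in> K \<and> \<phi> (snd (z i)) (fst (z i)) = fst (z i) \<and>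
        L \<le> snd (z i) \<and> snd (z i) \<le> L + \<sigma>"
      and sep: "\<forall>i\<in>I. \<forall>j\<in>I. (\<forall>s. dist (\<phi> s (fst (z i))) (\<phi> s (fst (z j))) \<le> e) \<longrightarrow> i = j"
    \<comment> \<open>Base points of the same orbit are compared by their flow time from a reference point that
      depends on the orbit only.\<close>
    define base where "base = (\<lambda>S :: 'a set. SOME x. x \<in> S)"
    have "\<exists>u. fst (z i) = \<phi> u (base (orb (fst (z i)))) \<and> 0 \<le> u \<and> u \<le> L + \<sigma>" if i: "i \<in> I" for i
    proof -
      define y where "y = base (orb (fst (z i)))"
      have T: "snd (z i) > 0" "snd (z i) \<le> L + \<sigma>" using z i L by force+
      have "y \<in> orb (fst (z i))" unfolding y_def base_def by (rule someI, rule orb_self)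
      then obtain t where t: "y = \<phi> t (fst (z i))" unfolding orb_def by blast
      then have x: "fst (z i) = \<phi> (- t) y" by (simp flip: flow_add)
      have "\<phi> (snd (z i)) y = y" using z i flow_commute[of "snd (z i)" t] by (simp add: t)
      define v where "v = - t - of_int \<lfloor>- t / snd (z i)\<rfloor> * snd (z i)"
      have "\<phi> (- t) y = \<phi> v y" unfolding v_def by (rule flow_mod_period) fact+
      moreover have "0 \<le> v" "v < snd (z i)" unfolding v_def using mod_period_bounds[OF T(1)] by blast+
      ultimately show ?thesis unfolding y_def[symmetric] using x T(2) by (intro exI[of _ v]) simp
    qed
    then obtain u where u: "\<And>i. i \<in> I \<Longrightarrow> fst (z i) = \<phi> (u i) (base (orb (fst (z i))))"
      "\<And>i. i \<in> I \<Longrightarrow> 0 \<le> u i" "\<And>i. i \<in> I \<Longrightarrow> u i \<le> L + \<sigma>"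
      by metis
    define \<Gamma> where "\<Gamma> = (\<lambda>i. (orb (fst (z i)), snd (z i))) ` I"
    define J where "J = {0..\<lfloor>(L + \<sigma>) / \<nu>\<rfloor>}"
    define f where "f = (\<lambda>i. ((orb (fst (z i)), snd (z i)), window_index \<nu> 0 (u i)))"
    have "inj_on f I"
    proof
      fix i j assume ij: "i \<in> I" "j \<in> I" "f i = f j"
      then have eq: "orb (fst (z i)) = orb (fst (z j))" "window_index \<nu> 0 (u i) = window_index \<nu> 0 (u j)"
        by (auto simp: f_def)
      have "\<bar>u j - u i\<bar> < \<nu>"
        using window_index_bounds[OF \<nu>, where L = 0 and t = "u i"]
          window_index_bounds[OF \<nu>, where L = 0 and t = "u j"]
        unfolding eq(2) by linarith
      have "fst (z j) = \<phi> (u j - u i) (\<phi> (u i) (base (orb (fst (z i)))))"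
        using u(1)[OF ij(2)] eq(1) by (simp flip: flow_add)
      then have zj: "fst (z j) = \<phi> (u j - u i) (fst (z i))" using u(1)[OF ij(1)] by simp
      have "dist (\<phi> s (fst (z i))) (\<phi> s (fst (z j))) \<le> e" for s
      proof -
        have "dist (\<phi> s (fst (z i))) (\<phi> s (fst (z j))) \<le> B * \<bar>u j - u i\<bar>"
          using B(2)[of "\<phi> s (fst (z i))" "u j - u i"] unfolding zj by (simp only: flow_commute[of s])
        also have "\<dots> \<le> B * \<nu>" using \<open>\<bar>u j - u i\<bar> < \<nu>\<close> B(1) by (intro mult_left_mono) auto
        finally show ?thesis using B(1) by (simp add: \<nu>_def)
      qed
      then show "i = j" using sep ij by blast
    qed
    moreover have "f ` I \<subseteq> \<Gamma> \<times> J"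
      using u(2,3) window_index_range[OF \<nu>, of 0 _ "L + \<sigma>"] by (auto simp: f_def \<Gamma>_def J_def)
    moreover have fin: "finite \<Gamma>" "finite J" using I by (simp_all add: \<Gamma>_def J_def)
    ultimately have "card I \<le> card (\<Gamma> \<times> J)" using card_inj_on_le by blast
    then have "real (card I) \<le> real (card J) * real (card \<Gamma>)"
      by (metis card_cartesian_product mult.commute of_nat_le_iff of_nat_mult)
    also have "real (card J) \<le> D * L"
    proof -
      have "real (card J) = of_int \<lfloor>(L + \<sigma>) / \<nu>\<rfloor> + 1"
        using \<nu> L assms by (simp add: J_def)
      also have "\<dots> \<le> (L + \<sigma>) / \<nu> + 1" by simp
      also have "\<dots> \<le> (L + \<sigma> * L) / \<nu> + L"
        using L \<nu> assms mult_left_mono[of 1 L \<sigma>] by (intro add_mono divide_right_mono) auto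
      also have "\<dots> = D * L" by (simp add: D_def field_simps add_divide_distrib)
      finally show ?thesis .
    qed
    finally have "real (card I) \<le> D * L * real (card \<Gamma>)" by (simp add: mult_right_mono)
    moreover have "\<Gamma> \<subseteq> orbits_meeting \<phi> K L (L + \<sigma>)"
      using z L by (force simp: \<Gamma>_def intro!: orbits_meetingI)
    ultimately show "\<exists>\<Gamma>. finite \<Gamma> \<and> \<Gamma> \<subseteq> orbits_meeting \<phi> K L (L + \<sigma>) \<and>
        real (card I) \<le> D * L * real (card \<Gamma>)"
      using fin(1) by blast
  qed
qed

text \<open>Conversely, base points of distinct periodic orbits with nearly equal periods are separated if
  they lie in a common small cell.\<close>

lemma arc_family_of_orbits:
  assumes K: "compact K" and e: "e > 0" and r: "r > 0" and exp: "expansive_at K e w r"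
  shows "\<exists>D. \<forall>L>0. \<forall>\<Gamma>. finite \<Gamma> \<and> \<Gamma> \<subseteq> orbits_meeting \<phi> K L (L + w) \<longrightarrow>
    (\<exists>E. arc_family K e w L E \<and> card \<Gamma> \<le> D * card E)"
proof -
  obtain k cell where k: "finite k" "\<And>x. x \<in> K \<Longrightarrow> cell x \<in> k \<and> dist (cell x) x < r / 2"
    using compact_cells[OF K, of "r / 2"] r half_gt_zero by metis
  show ?thesis
  proof (intro exI[of _ "card k"] allI impI)
    fix L :: real and \<Gamma> assume L: "L > 0" and \<Gamma>: "finite \<Gamma> \<and> \<Gamma> \<subseteq> orbits_meeting \<phi> K L (L + w)"
    have "\<forall>\<gamma>. \<exists>x. \<gamma> \<in> \<Gamma> \<longrightarrow> x \<in> K \<and> fst \<gamma> = orb x \<and> \<phi> (snd \<gamma>) x = x \<and> snd \<gamma> > 0 \<and>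
        L \<le> snd \<gamma> \<and> snd \<gamma> \<le> L + w"
      using \<Gamma> orbits_meetingE by (metis subsetD)
    then obtain pt where pt: "\<And>\<gamma>. \<gamma> \<in> \<Gamma> \<Longrightarrow> pt \<gamma> \<in> K \<and> fst \<gamma> = orb (pt \<gamma>) \<and>
        \<phi> (snd \<gamma>) (pt \<gamma>) = pt \<gamma> \<and> snd \<gamma> > 0 \<and> L \<le> snd \<gamma> \<and> snd \<gamma> \<le> L + w"
      by metis
    obtain \<Gamma>' where \<Gamma>': "\<Gamma>' \<subseteq> \<Gamma>" "card \<Gamma> \<le> card k * card \<Gamma>'"
      "\<And>\<gamma> \<gamma>'. \<gamma> \<in> \<Gamma>' \<Longrightarrow> \<gamma>' \<in> \<Gamma>' \<Longrightarrow> cell (pt \<gamma>) = cell (pt \<gamma>')"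
      using large_fibre[of \<Gamma> k "\<lambda>\<gamma>. cell (pt \<gamma>)"] \<Gamma> k pt by (smt (verit))
    define E where "E = (\<lambda>\<gamma>. (pt \<gamma>, snd \<gamma>)) ` \<Gamma>'"
    have eq: "\<gamma> = \<gamma>'" if "\<gamma> \<in> \<Gamma>'" "\<gamma>' \<in> \<Gamma>'"
      "\<forall>s\<in>{0..min (snd \<gamma>) (snd \<gamma>')}. dist (\<phi> s (pt \<gamma>)) (\<phi> s (pt \<gamma>')) \<le> e" for \<gamma> \<gamma>'
    proof -
      have g: "\<gamma> \<in> \<Gamma>" "\<gamma>' \<in> \<Gamma>" using that \<Gamma>'(1) by auto
      note p = pt[OF g(1)] pt[OF g(2)]
      have "dist (pt \<gamma>) (pt \<gamma>') < r / 2 + r / 2"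
        using k(2)[of "pt \<gamma>"] k(2)[of "pt \<gamma>'"] p \<Gamma>'(3)[OF that(1,2)]
          dist_triangle3[of "pt \<gamma>" "pt \<gamma>'" "cell (pt \<gamma>)"] by auto
      then have "dist (pt \<gamma>) (pt \<gamma>') \<le> r" "\<bar>snd \<gamma> - snd \<gamma>'\<bar> \<le> w" using p by auto
      then have "snd \<gamma> = snd \<gamma>'" "\<exists>u. pt \<gamma>' = \<phi> u (pt \<gamma>)"
        using exp[unfolded expansive_at_def, rule_format, of "pt \<gamma>" "pt \<gamma>'" "snd \<gamma>" "snd \<gamma>'"] p that(3)
        by auto
      then show ?thesis using p orb_flow by (metis prod_eqI)
    qed
    have "inj_on (\<lambda>\<gamma>. (pt \<gamma>, snd \<gamma>)) \<Gamma>'"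
    proof
      fix \<gamma> \<gamma>' assume g: "\<gamma> \<in> \<Gamma>'" "\<gamma>' \<in> \<Gamma>'" "(pt \<gamma>, snd \<gamma>) = (pt \<gamma>', snd \<gamma>')"
      then show "\<gamma> = \<gamma>'" by (intro eq) (use e in auto)
    qed
    then have "card E = card \<Gamma>'" unfolding E_def by (rule card_image)
    moreover have "separated e E"
      unfolding separated_def E_def using eq by (fastforce simp: not_le)
    moreover have "finite E" using \<Gamma> \<Gamma>'(1) finite_subset unfolding E_def by blast
    moreover have "E \<subseteq> closed_arcs K" "\<forall>a\<in>E. L \<le> snd a \<and> snd a \<le> L + w"
      using pt \<Gamma>'(1) by (force simp: E_def closed_arcs_def)+
    ultimately show "\<exists>E. arc_family K e w L E \<and> card \<Gamma> \<le> card k * card E"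
      using \<Gamma>'(2) by (auto simp: arc_family_def)
  qed
qed

end

section \<open>Superadditivity\<close>

text \<open>Superadditivity: gluing the members of two arc families pairwise and passing to the most
  frequent transition times, base cell and period window yields an arc family of the same precision.
  The loss factor \<open>D\<close> does not depend on the lengths of the arcs.\<close>

lemma (in orbit_gluing) arc_family_product:
  assumes X: "compact X" "ball p (2 * \<epsilon>) \<subseteq> X" and e: "8 * \<epsilon> \<le> e" and w: "0 < w" and r: "0 < r"
    and exp: "expansive_at X e w r"
  shows "\<exists>C D. C \<ge> 0 \<and> D > 0 \<and> (\<forall>L1 L2 E1 E2. L1 \<ge> 0 \<longrightarrow> L2 \<ge> 0 \<longrightarrow>
    arc_family X e w L1 E1 \<longrightarrow> arc_family X e w L2 E2 \<longrightarrow>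
    (\<exists>L E. L1 + L2 \<le> L \<and> L \<le> L1 + L2 + C \<and> arc_family X e w L E \<and>
      card E1 * card E2 \<le> D * card E))"
proof -
  obtain C0 where C0: "C0 \<ge> 0" "\<And>c. c \<in> F \<Longrightarrow> c \<le> C0" using transition_bound by blast
  obtain k cell where k: "finite k" "\<And>x. x \<in> X \<Longrightarrow> cell x \<in> k \<and> dist (cell x) x < r / 2"
    using compact_cells[OF X(1), of "r / 2"] r half_gt_zero by metis
  define C where "C = 2 * w + (3 * C0 + \<epsilon>)"
  define J where "J = F \<times> F \<times> F \<times> k \<times> {0..\<lfloor>C / w\<rfloor>}"
  have fin: "finite J" using finite_F k(1) by (simp add: J_def)
  have C: "C \<ge> 0" using C0 eps_pos w by (simp add: C_def)
  show ?thesis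
  proof (rule exI[of _ C], rule exI[of _ "card J + 1"], intro conjI C allI impI)
    fix L1 L2 :: real and E1 E2
    assume L: "L1 \<ge> 0" "L2 \<ge> 0" and E1: "arc_family X e w L1 E1" and E2: "arc_family X e w L2 E2"
    define f where "f = (\<lambda>(a, b). (c1 (fst a) (fst b), c2 (fst a) (fst b), c3 (fst a) (fst b),
      cell (fst (G a b)), window_index w (L1 + L2) (snd (G a b))))"
    have arcs: "a \<in> closed_arcs X" "b \<in> closed_arcs X" if "(a, b) \<in> E1 \<times> E2" for a b
      using that E1 E2 by (auto simp: arc_family_def)
    have per: "L1 + L2 \<le> snd (G a b)" "snd (G a b) \<le> L1 + L2 + C" if ab: "(a, b) \<in> E1 \<times> E2" for a b
    proof -
      have "L1 \<le> snd a" "snd a \<le> L1 + w" "L2 \<le> snd b" "snd b \<le> L2 + w"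
        using ab E1 E2 by (auto simp: arc_family_def)
      then show "L1 + L2 \<le> snd (G a b)" "snd (G a b) \<le> L1 + L2 + C"
        using glued_period[OF arcs[OF ab] C0(2)] by (auto simp: C_def)
    qed
    have base: "fst (G a b) \<in> X" if ab: "(a, b) \<in> E1 \<times> E2" for a b
      using glued[OF arcs[OF ab]] X(2) by blast
    have "f x \<in> J" if "x \<in> E1 \<times> E2" for x
    proof -
      obtain a b where x: "x = (a, b)" by (cases x)
      have ab: "(a, b) \<in> E1 \<times> E2" using that x by simp
      have "fst a \<in> X" "fst b \<in> X" using arcs[OF ab] by (auto simp: closed_arcs_def)
      then show ?thesis
        unfolding x f_def J_def using times_F k(2)[OF base[OF ab]] window_index_range[OF w per[OF ab]]
        by simp
    qed
    then obtain S where S: "S \<subseteq> E1 \<times> E2" "card (E1 \<times> E2) \<le> card J * card S"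
      "\<And>x y. x \<in> S \<Longrightarrow> y \<in> S \<Longrightarrow> f x = f y"
      using large_fibre[of "E1 \<times> E2" J f] fin E1 E2 unfolding arc_family_def
      by (metis finite_cartesian_product)
    show "\<exists>L E. L1 + L2 \<le> L \<and> L \<le> L1 + L2 + C \<and> arc_family X e w L E \<and>
        card E1 * card E2 \<le> (card J + 1) * card E"
    proof (cases "S = {}")
      case True
      then have "card E1 * card E2 = 0" using S(2) by (simp add: card_cartesian_product)
      then show ?thesis using C
        by (intro exI[of _ "L1 + L2"] exI[of _ "{}"]) (auto simp: arc_family_def separated_def)
    next
      case False
      then obtain a0 b0 where s0: "(a0, b0) \<in> S" by auto
      define j where "j = window_index w (L1 + L2) (snd (G a0 b0))"
      define L where "L = L1 + L2 + of_int j * w"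
      define E where "E = (\<lambda>(a, b). G a b) ` S"
      have j: "window_index w (L1 + L2) (snd (G a b)) = j" if "(a, b) \<in> S" for a b
        using S(3)[OF that s0] by (simp add: f_def j_def)
      have bounds: "L \<le> snd (G a b)" "snd (G a b) \<le> L + w" if "(a, b) \<in> S" for a b
        using window_index_bounds[OF w, where L = "L1 + L2" and t = "snd (G a b)"] j[OF that]
        by (auto simp: L_def)
      \<comment> \<open>Glued orbits that are \<open>e\<close>-close are \<open>e / 2\<close>-close by expansivity, so the arcs they follow are
        \<open>4 * \<epsilon> + e / 2\<close>-close, which is at most \<open>e\<close>.\<close>
      have eq: "a = a' \<and> b = b'"
        if s: "(a, b) \<in> S" "(a', b') \<in> S" and close: "\<forall>s\<in>{0..min (snd (G a b)) (snd (G a' b'))}.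
          dist (\<phi> s (fst (G a b))) (\<phi> s (fst (G a' b'))) \<le> e" for a b a' b'
      proof -
        have E: "(a, b) \<in> E1 \<times> E2" "(a', b') \<in> E1 \<times> E2" using s S(1) by auto
        have times: "c1 (fst a) (fst b) = c1 (fst a') (fst b')" "c2 (fst a) (fst b) = c2 (fst a') (fst b')"
          "cell (fst (G a b)) = cell (fst (G a' b'))"
          using S(3)[OF s] by (auto simp: f_def)
        have "dist (fst (G a b)) (fst (G a' b')) < r / 2 + r / 2"
          using k(2)[OF base[OF E(1)]] k(2)[OF base[OF E(2)]] times(3)
            dist_triangle3[of "fst (G a b)" "fst (G a' b')" "cell (fst (G a b))"] by auto
        moreover have "\<bar>snd (G a b) - snd (G a' b')\<bar> \<le> w" using bounds s by (smt (verit))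
        moreover have "snd (G a b) > 0" "snd (G a' b') > 0"
          using glued_period(1)[OF arcs[OF E(1)] C0(2)] glued_period(1)[OF arcs[OF E(2)] C0(2)]
            arcs[OF E(1)] arcs[OF E(2)] by (auto simp: closed_arcs_def)
        ultimately have half: "dist (\<phi> s (fst (G a b))) (\<phi> s (fst (G a' b'))) \<le> e / 2" for s
          using exp[unfolded expansive_at_def, rule_format, of "fst (G a b)" "fst (G a' b')"
              "snd (G a b)" "snd (G a' b')"] base[OF E(1)] base[OF E(2)] close
            glued[OF arcs[OF E(1)]] glued[OF arcs[OF E(2)]] by auto
        have "a = a'"
          by (rule glued_first_eq[of E1 e a a' b b' "e / 2"])
            (use E E1 arcs[OF E(1)] arcs[OF E(2)] e half times in \<open>auto simp: arc_family_def\<close>)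
        moreover have "b = b'"
          by (rule glued_second_eq[of E2 e b b' a "e / 2"])
            (use E E2 arcs[OF E(1)] arcs[OF E(2)] e half times \<open>a = a'\<close> in \<open>auto simp: arc_family_def\<close>)
        ultimately show ?thesis by simp
      qed
      have e_pos: "e \<ge> 0" using e eps_pos by linarith
      have "inj_on (\<lambda>(a, b). G a b) S"
      proof
        fix x y assume xy: "x \<in> S" "y \<in> S" "(\<lambda>(a, b). G a b) x = (\<lambda>(a, b). G a b) y"
        show "x = y"
          using eq[of "fst x" "snd x" "fst y" "snd y"] xy e_pos
          by (auto simp: case_prod_unfold prod_eq_iff)
      qed
      then have "card E = card S" unfolding E_def by (rule card_image)
      then have "card E1 * card E2 \<le> (card J + 1) * card E"
        using S(2) by (simp add: card_cartesian_product)
      moreover have "separated e E"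
        unfolding separated_def
      proof (intro ballI impI)
        fix x y assume xy: "x \<in> E" "y \<in> E" "x \<noteq> y"
        from xy(1,2) obtain a b a' b' where ab:
          "x = G a b" "y = G a' b'" "(a, b) \<in> S" "(a', b') \<in> S" by (auto simp: E_def)
        show "\<exists>s\<in>{0..min (snd x) (snd y)}. e < dist (\<phi> s (fst x)) (\<phi> s (fst y))"
        proof (rule ccontr)
          assume "\<not> ?thesis"
          then have "\<forall>s\<in>{0..min (snd x) (snd y)}. dist (\<phi> s (fst x)) (\<phi> s (fst y)) \<le> e"
            by (simp add: not_less)
          then show False using eq[OF ab(3,4)] ab(1,2) xy(3) by blast
        qed
      qed
      moreover have "finite E"
        using S(1) E1 E2 unfolding E_def arc_family_def
        by (meson finite_SigmaI finite_imageI finite_subset)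
      moreover have "x \<in> closed_arcs X \<and> L \<le> snd x \<and> snd x \<le> L + w" if x: "x \<in> E" for x
      proof -
        obtain a b where ab: "x = G a b" "(a, b) \<in> S" using x unfolding E_def by auto
        then have E: "(a, b) \<in> E1 \<times> E2" using S(1) by blast
        show ?thesis
          using ab(1) bounds[OF ab(2)] base[OF E] glued[OF arcs[OF E]] per[OF E] L
          by (auto simp: closed_arcs_def)
      qed
      ultimately have "arc_family X e w L E" "card E1 * card E2 \<le> (card J + 1) * card E"
        unfolding arc_family_def by auto
      moreover have "L1 + L2 \<le> L" "L \<le> L1 + L2 + C"
      proof -
        have E: "(a0, b0) \<in> E1 \<times> E2" using s0 S(1) by blast
        have "j \<ge> 0" using window_index_range[OF w per[OF E]] by (simp add: j_def)
        then show "L1 + L2 \<le> L" using w by (simp add: L_def)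
        show "L \<le> L1 + L2 + C" using bounds(1)[OF s0] per(2)[OF E] by simp
      qed
      ultimately show ?thesis by blast
    qed
  qed simp
qed

text \<open>Gluing with \<open>k\<close> rounds of a fixed periodic orbit of period \<open>\<tau>\<close> adjusts the period up to an error
  of about \<open>\<tau>\<close>: the width \<open>w\<close> of the given window and the error \<open>\<epsilon>\<close> of the closing lemma on both sides
  add at most \<open>3\<close>. Since the transition times do not depend on \<open>k\<close>, it can be chosen after a most frequent
  triple of transition times.\<close>

lemma (in orbit_gluing) orbits_of_arc_family:
  assumes X: "ball p (2 * \<epsilon>) \<subseteq> X" and e: "8 * \<epsilon> \<le> e" "\<epsilon> \<le> 1" and w: "0 < w" "w \<le> 1"
    and x0: "x0 \<in> X" "\<phi> \<tau> x0 = x0" "\<tau> \<ge> 1"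
  shows "\<exists>C D. C \<ge> 0 \<and> D > 0 \<and> (\<forall>L1 E L. L1 \<ge> 0 \<longrightarrow> arc_family X e w L1 E \<longrightarrow> L \<ge> L1 + C \<longrightarrow> L \<ge> 1 \<longrightarrow>
    (\<exists>\<Gamma>. finite \<Gamma> \<and> \<Gamma> \<subseteq> orbits_meeting \<phi> X L (L + (\<tau> + 3)) \<and>
      real (card E) \<le> D * L * real (card \<Gamma>)))"
proof -
  obtain C0 where C0: "C0 \<ge> 0" "\<And>c. c \<in> F \<Longrightarrow> c \<le> C0" using transition_bound by blast
  have e2: "e / 2 > 0" using e(1) eps_pos by linarith
  obtain D where D: "D > 0" "\<And>L (I :: ('a \<times> real) set) z. L \<ge> 1 \<Longrightarrow> finite I \<Longrightarrow>
      (\<forall>i\<in>I. fst (z i) \<in> X \<and> \<phi> (snd (z i)) (fst (z i)) = fst (z i) \<and>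
        L \<le> snd (z i) \<and> snd (z i) \<le> L + (\<tau> + 3)) \<Longrightarrow>
      (\<forall>i\<in>I. \<forall>j\<in>I. (\<forall>s. dist (\<phi> s (fst (z i))) (\<phi> s (fst (z j))) \<le> e / 2) \<longrightarrow> i = j) \<Longrightarrow>
      (\<exists>\<Gamma>. finite \<Gamma> \<and> \<Gamma> \<subseteq> orbits_meeting \<phi> X L (L + (\<tau> + 3)) \<and>
        real (card I) \<le> D * L * real (card \<Gamma>))"
    using orbits_of_separated[OF e2, of "\<tau> + 3" X] x0(3) by auto
  define N where "N = card (F \<times> F \<times> F) + 1"
  show ?thesis
  proof (rule exI[of _ "3 * C0"], rule exI[of _ "real N * D"], intro conjI allI impI)
    fix L1 E L
    assume L1: "L1 \<ge> 0" and E: "arc_family X e w L1 E" and L: "L \<ge> L1 + 3 * C0" "L \<ge> 1"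
    have EX: "a \<in> closed_arcs X" "fst a \<in> X" if "a \<in> E" for a
      using that E by (auto simp: arc_family_def closed_arcs_def)
    define f where "f = (\<lambda>a :: 'a \<times> real. (c1 (fst a) x0, c2 (fst a) x0, c3 (fst a) x0))"
    have "finite E" using E by (simp add: arc_family_def)
    moreover have "finite (F \<times> F \<times> F)" using finite_F by simp
    moreover have "f a \<in> F \<times> F \<times> F" if "a \<in> E" for a
      using times_F[OF EX(2)[OF that] x0(1)] by (simp add: f_def)
    ultimately obtain S where S: "S \<subseteq> E" "card E \<le> card (F \<times> F \<times> F) * card S" and
      same: "\<And>a a'. a \<in> S \<Longrightarrow> a' \<in> S \<Longrightarrow> f a = f a'"
      using large_fibre[of E "F \<times> F \<times> F" f] by metis
    have "\<exists>c\<le>3 * C0. \<forall>a\<in>S. c1 (fst a) x0 + c2 (fst a) x0 + c3 (fst a) x0 = c"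
    proof (cases "S = {}")
      case True then show ?thesis by auto
    next
      case False
      then obtain a0 where a0: "a0 \<in> S" by blast
      then have "fst a0 \<in> X" using EX S(1) by blast
      then have "c1 (fst a0) x0 + c2 (fst a0) x0 + c3 (fst a0) x0 \<le> 3 * C0"
        using times_F[OF _ x0(1), of "fst a0"] C0(2)[of "c1 (fst a0) x0"]
          C0(2)[of "c2 (fst a0) x0"] C0(2)[of "c3 (fst a0) x0"] by linarith
      moreover have "\<forall>a\<in>S. c1 (fst a) x0 + c2 (fst a) x0 + c3 (fst a) x0 =
          c1 (fst a0) x0 + c2 (fst a0) x0 + c3 (fst a0) x0"
        using same[OF _ a0] by (simp add: f_def)
      ultimately show ?thesis by blast
    qed
    then obtain c where c: "c \<le> 3 * C0"
      "\<And>a. a \<in> S \<Longrightarrow> c1 (fst a) x0 + c2 (fst a) x0 + c3 (fst a) x0 = c" by blast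
    define k where "k = nat \<lceil>(L + \<epsilon> - L1 - c) / \<tau>\<rceil>"
    have "(L + \<epsilon> - L1 - c) / \<tau> \<ge> 0" using L(1) c(1) eps_pos x0(3) by simp
    then have "(L + \<epsilon> - L1 - c) / \<tau> \<le> real k" "real k < (L + \<epsilon> - L1 - c) / \<tau> + 1"
      unfolding k_def by linarith+
    then have k: "L + \<epsilon> \<le> L1 + c + real k * \<tau>" "L1 + c + real k * \<tau> < L + \<epsilon> + \<tau>"
      using x0(3) by (auto simp: field_simps)
    define b where "b = (x0, real k * \<tau>)"
    have b: "b \<in> closed_arcs X" using x0 flow_multiple[OF x0(2), of k] by (auto simp: closed_arcs_def b_def)
    have "\<exists>\<Gamma>. finite \<Gamma> \<and> \<Gamma> \<subseteq> orbits_meeting \<phi> X L (L + (\<tau> + 3)) \<and>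
        real (card S) \<le> D * L * real (card \<Gamma>)"
    proof (rule D(2)[where z = "\<lambda>a. G a b"])
      show "L \<ge> 1" by fact
      show "finite S" using S(1) E finite_subset unfolding arc_family_def by blast
      show "\<forall>a\<in>S. fst (G a b) \<in> X \<and> \<phi> (snd (G a b)) (fst (G a b)) = fst (G a b) \<and>
          L \<le> snd (G a b) \<and> snd (G a b) \<le> L + (\<tau> + 3)"
      proof
        fix a assume a: "a \<in> S"
        then have aE: "a \<in> E" using S(1) by blast
        have "L1 \<le> snd a" "snd a \<le> L1 + w" using aE E by (auto simp: arc_family_def)
        moreover have "\<bar>snd (G a b) - (snd a + c + real k * \<tau>)\<bar> \<le> \<epsilon>"
          using glued[OF EX(1)[OF aE] b] c(2)[OF a] by (simp add: b_def algebra_simps)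
        ultimately have "L \<le> snd (G a b) \<and> snd (G a b) \<le> L + (\<tau> + 3)"
          using k e(2) w by linarith
        then show "fst (G a b) \<in> X \<and> \<phi> (snd (G a b)) (fst (G a b)) = fst (G a b) \<and>
          L \<le> snd (G a b) \<and> snd (G a b) \<le> L + (\<tau> + 3)"
          using glued[OF EX(1)[OF aE] b] X by blast
      qed
      show "\<forall>a\<in>S. \<forall>a'\<in>S. (\<forall>s. dist (\<phi> s (fst (G a b))) (\<phi> s (fst (G a' b))) \<le> e / 2) \<longrightarrow> a = a'"
      proof (intro ballI impI)
        fix a a' assume a: "a \<in> S" "a' \<in> S" "\<forall>s. dist (\<phi> s (fst (G a b))) (\<phi> s (fst (G a' b))) \<le> e / 2"
        show "a = a'"
          by (rule glued_first_eq[of E e a a' b b "e / 2"])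
            (use a b S(1) E e same[OF a(1,2)] in \<open>auto simp: arc_family_def b_def f_def\<close>)
      qed
    qed
    then obtain \<Gamma> where \<Gamma>: "finite \<Gamma>" "\<Gamma> \<subseteq> orbits_meeting \<phi> X L (L + (\<tau> + 3))"
      "real (card S) \<le> D * L * real (card \<Gamma>)" by blast
    have "real (card E) \<le> real N * real (card S)"
      using S(2) unfolding N_def of_nat_mult[symmetric] of_nat_le_iff by simp
    also have "\<dots> \<le> real N * (D * L * real (card \<Gamma>))" using \<Gamma>(3) by (intro mult_left_mono) auto
    finally show "\<exists>\<Gamma>. finite \<Gamma> \<and> \<Gamma> \<subseteq> orbits_meeting \<phi> X L (L + (\<tau> + 3)) \<and>
      real (card E) \<le> real N * D * L * real (card \<Gamma>)"
      using \<Gamma>(1,2) by (auto simp: mult.assoc)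
  qed (use C0 D in \<open>auto simp: N_def\<close>)
qed

section \<open>Independence of the compact set and of the window\<close>

context H_flow
begin

text \<open>Orbits meeting \<open>K\<close> with period in a long window: the most populated short window.\<close>

lemma orbits_short_window:
  assumes "\<sigma> \<ge> 0" "w > 0"
  shows "\<exists>N. \<forall>L \<Gamma>. finite \<Gamma> \<and> \<Gamma> \<subseteq> orbits_meeting \<phi> K L (L + \<sigma>) \<longrightarrow>
    (\<exists>L' \<Gamma>'. L \<le> L' \<and> L' \<le> L + \<sigma> \<and> \<Gamma>' \<subseteq> \<Gamma> \<and> \<Gamma>' \<subseteq> orbits_meeting \<phi> K L' (L' + w) \<and>
      card \<Gamma> \<le> N * card \<Gamma>')"
proof (intro exI[of _ "card {0..\<lfloor>\<sigma> / w\<rfloor>}"] allI impI)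
  fix L \<Gamma> assume \<Gamma>: "finite \<Gamma> \<and> \<Gamma> \<subseteq> orbits_meeting \<phi> K L (L + \<sigma>)"
  have per: "L \<le> snd \<gamma>" "snd \<gamma> \<le> L + \<sigma>" if "\<gamma> \<in> \<Gamma>" for \<gamma>
    using that \<Gamma> by (auto simp: orbits_meeting_def)
  define f where "f = (\<lambda>\<gamma> :: 'a set \<times> real. window_index w L (snd \<gamma>))"
  have "f \<gamma> \<in> {0..\<lfloor>\<sigma> / w\<rfloor>}" if "\<gamma> \<in> \<Gamma>" for \<gamma>
    unfolding f_def by (rule window_index_range[OF assms(2) per[OF that]])
  with \<Gamma> obtain \<Gamma>' where \<Gamma>': "\<Gamma>' \<subseteq> \<Gamma>" "card \<Gamma> \<le> card {0..\<lfloor>\<sigma> / w\<rfloor>} * card \<Gamma>'"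
    "\<And>\<gamma> \<gamma>'. \<gamma> \<in> \<Gamma>' \<Longrightarrow> \<gamma>' \<in> \<Gamma>' \<Longrightarrow> f \<gamma> = f \<gamma>'"
    using large_fibre[of \<Gamma> "{0..\<lfloor>\<sigma> / w\<rfloor>}" f] by (metis finite_atLeastAtMost_int)
  show "\<exists>L' \<Gamma>'. L \<le> L' \<and> L' \<le> L + \<sigma> \<and> \<Gamma>' \<subseteq> \<Gamma> \<and> \<Gamma>' \<subseteq> orbits_meeting \<phi> K L' (L' + w) \<and>
      card \<Gamma> \<le> card {0..\<lfloor>\<sigma> / w\<rfloor>} * card \<Gamma>'"
  proof (cases "\<Gamma>' = {}")
    case True
    then show ?thesis using \<Gamma>'(1,2) assms(1) by (intro exI[of _ L] exI[of _ "{}"]) auto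
  next
    case False
    then obtain \<gamma>0 where \<gamma>0: "\<gamma>0 \<in> \<Gamma>'" by blast
    define L' where "L' = L + of_int (f \<gamma>0) * w"
    have bounds: "L' \<le> snd \<gamma>" "snd \<gamma> \<le> L' + w" if "\<gamma> \<in> \<Gamma>'" for \<gamma>
      using window_index_bounds[OF assms(2), where L = L and t = "snd \<gamma>"] \<Gamma>'(3)[OF that \<gamma>0]
      by (auto simp: L'_def f_def)
    have "\<gamma> \<in> orbits_meeting \<phi> K L' (L' + w)" if "\<gamma> \<in> \<Gamma>'" for \<gamma>
    proof -
      have "\<gamma> \<in> orbits_meeting \<phi> K L (L + \<sigma>)" using that \<Gamma>'(1) \<Gamma> by blast
      then show ?thesis using bounds[OF that] by (simp add: orbits_meeting_def)
    qed
    moreover have \<gamma>0\<Gamma>: "\<gamma>0 \<in> \<Gamma>" using \<gamma>0 \<Gamma>'(1) by blast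
    have "L' \<le> L + \<sigma>" using bounds(1)[OF \<gamma>0] per(2)[OF \<gamma>0\<Gamma>] by simp
    moreover have "f \<gamma>0 \<ge> 0"
      using window_index_range[OF assms(2) per[OF \<gamma>0\<Gamma>]] by (simp add: f_def)
    then have "L \<le> L'" using assms(2) by (simp add: L'_def)
    ultimately show ?thesis using \<Gamma>'(1,2) by (intro exI[of _ L'] exI[of _ \<Gamma>']) auto
  qed
qed

text \<open>Each periodic orbit meeting \<open>K1\<close> is prolonged, by a bounded time, to one that meets \<open>K2\<close>. The
  second arc of the gluing is trivial, with return time \<open>0\<close>.\<close>

lemma orbits_meeting_transfer:
  assumes K: "compact K1" "interior K2 \<noteq> {}" and \<sigma>: "\<sigma>1 > 0" "\<sigma>2 > 0"
  shows "\<exists>C D. C \<ge> 0 \<and> D > 0 \<and> (\<forall>L\<ge>1. \<forall>\<Gamma>. finite \<Gamma> \<and> \<Gamma> \<subseteq> orbits_meeting \<phi> K1 L (L + \<sigma>1) \<longrightarrow>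
    (\<exists>L' \<Gamma>'. L \<le> L' \<and> L' \<le> L + C \<and> finite \<Gamma>' \<and> \<Gamma>' \<subseteq> orbits_meeting \<phi> K2 L' (L' + \<sigma>2) \<and>
      real (card \<Gamma>) \<le> D * L * real (card \<Gamma>')))"
proof -
  obtain e w r where ewr: "0 < e" "0 < w" "w \<le> 1" "0 < r" "expansive_at K1 e w r"
    using expansive_scale[OF K(1)] by metis
  obtain p R where p: "R > 0" "ball p R \<subseteq> K2"
    using K(2) by (meson equals0I mem_interior)
  define \<epsilon> where "\<epsilon> = min (e / 8) (R / 2)"
  have \<epsilon>: "\<epsilon> > 0" "8 * \<epsilon> \<le> e" "2 * \<epsilon> \<le> R" using ewr p by (auto simp: \<epsilon>_def)
  obtain F c1 c2 c3 G where "orbit_gluing A g \<phi> K1 p \<epsilon> F c1 c2 c3 G"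
    using orbit_gluing_exists[OF K(1) \<epsilon>(1)] by blast
  then interpret orbit_gluing A g \<phi> K1 p \<epsilon> F c1 c2 c3 G .
  obtain C0 where C0: "C0 \<ge> 0" "\<And>c. c \<in> F \<Longrightarrow> c \<le> C0" using transition_bound by blast
  define C where "C = w + (3 * C0 + \<epsilon>)"
  have C: "C \<ge> 0" using C0 \<epsilon> ewr by (simp add: C_def)
  obtain N1 where N1: "\<forall>L \<Gamma>. finite \<Gamma> \<and> \<Gamma> \<subseteq> orbits_meeting \<phi> K1 L (L + \<sigma>1) \<longrightarrow>
      (\<exists>L' \<Gamma>'. L \<le> L' \<and> L' \<le> L + \<sigma>1 \<and> \<Gamma>' \<subseteq> \<Gamma> \<and> \<Gamma>' \<subseteq> orbits_meeting \<phi> K1 L' (L' + w) \<and>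
        card \<Gamma> \<le> N1 * card \<Gamma>')"
    using orbits_short_window[of \<sigma>1 w K1, OF less_imp_le[OF \<sigma>(1)] ewr(2)] ..
  obtain N2 where N2: "\<forall>L \<Gamma>. finite \<Gamma> \<and> \<Gamma> \<subseteq> orbits_meeting \<phi> K2 L (L + C) \<longrightarrow>
      (\<exists>L' \<Gamma>'. L \<le> L' \<and> L' \<le> L + C \<and> \<Gamma>' \<subseteq> \<Gamma> \<and> \<Gamma>' \<subseteq> orbits_meeting \<phi> K2 L' (L' + \<sigma>2) \<and>
        card \<Gamma> \<le> N2 * card \<Gamma>')"
    using orbits_short_window[of C \<sigma>2 K2, OF C \<sigma>(2)] ..
  obtain N3 where N3: "\<forall>L>0. \<forall>\<Gamma>. finite \<Gamma> \<and> \<Gamma> \<subseteq> orbits_meeting \<phi> K1 L (L + w) \<longrightarrow>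
      (\<exists>E. arc_family K1 e w L E \<and> card \<Gamma> \<le> N3 * card E)"
    using arc_family_of_orbits[OF K(1) ewr(1,4,5)] ..
  obtain D where D: "D > 0" "\<And>L (I :: ('a \<times> real) set) z. L \<ge> 1 \<Longrightarrow> finite I \<Longrightarrow>
      (\<forall>i\<in>I. fst (z i) \<in> K2 \<and> \<phi> (snd (z i)) (fst (z i)) = fst (z i) \<and>
        L \<le> snd (z i) \<and> snd (z i) \<le> L + C) \<Longrightarrow>
      (\<forall>i\<in>I. \<forall>j\<in>I. (\<forall>s. dist (\<phi> s (fst (z i))) (\<phi> s (fst (z j))) \<le> e / 2) \<longrightarrow> i = j) \<Longrightarrow>
      (\<exists>\<Gamma>. finite \<Gamma> \<and> \<Gamma> \<subseteq> orbits_meeting \<phi> K2 L (L + C) \<and>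
        real (card I) \<le> D * L * real (card \<Gamma>))"
    using orbits_of_separated[of "e / 2" C K2] ewr(1) C by auto
  define N where "N = real N1 * real N3 * real (card F) * real N2"
  define D' where "D' = N * D * (1 + \<sigma>1) + 1"
  have "N \<ge> 0" by (simp add: N_def)
  have D': "D' > 0" using D(1) \<open>N \<ge> 0\<close> \<sigma> by (simp add: D'_def add_nonneg_pos)
  show ?thesis
  proof (rule exI[of _ "\<sigma>1 + C"], rule exI[of _ D'], intro conjI allI impI D')
    show "0 \<le> \<sigma>1 + C" using \<sigma> C by simp
    fix L \<Gamma> assume L: "L \<ge> 1" and \<Gamma>: "finite \<Gamma> \<and> \<Gamma> \<subseteq> orbits_meeting \<phi> K1 L (L + \<sigma>1)"
    obtain L1 \<Gamma>1 where L1: "L \<le> L1" "L1 \<le> L + \<sigma>1" and \<Gamma>1: "\<Gamma>1 \<subseteq> \<Gamma>"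
      "\<Gamma>1 \<subseteq> orbits_meeting \<phi> K1 L1 (L1 + w)" "card \<Gamma> \<le> N1 * card \<Gamma>1"
      using N1[rule_format, OF \<Gamma>] by blast
    have "finite \<Gamma>1" using \<Gamma>1(1) \<Gamma> finite_subset by blast
    then obtain E where E: "arc_family K1 e w L1 E" "card \<Gamma>1 \<le> N3 * card E"
      using N3[rule_format, of L1 \<Gamma>1] \<Gamma>1(2) L1 L by auto
    have EX: "a \<in> closed_arcs K1" "fst a \<in> K1" "(fst a, 0) \<in> closed_arcs K1" if "a \<in> E" for a
      using that E by (auto simp: arc_family_def closed_arcs_def)
    define f where "f = (\<lambda>a :: 'a \<times> real. c1 (fst a) (fst a))"
    have "finite E" using E by (simp add: arc_family_def)
    moreover have "f a \<in> F" if "a \<in> E" for a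
      using times_F[OF EX(2)[OF that] EX(2)[OF that]] by (simp add: f_def)
    ultimately obtain S where S: "S \<subseteq> E" "card E \<le> card F * card S" and
      same: "\<And>a a'. a \<in> S \<Longrightarrow> a' \<in> S \<Longrightarrow> f a = f a'"
      using large_fibre[of E F f] finite_F by metis
    have "\<exists>\<Gamma>. finite \<Gamma> \<and> \<Gamma> \<subseteq> orbits_meeting \<phi> K2 L1 (L1 + C) \<and>
        real (card S) \<le> D * L1 * real (card \<Gamma>)"
    proof (rule D(2)[where z = "\<lambda>a. G a (fst a, 0)"])
      show "L1 \<ge> 1" using L L1 by simp
      show "finite S" using S(1) \<open>finite E\<close> finite_subset by blast
      show "\<forall>a\<in>S. fst (G a (fst a, 0)) \<in> K2 \<and>
          \<phi> (snd (G a (fst a, 0))) (fst (G a (fst a, 0))) = fst (G a (fst a, 0)) \<and>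
          L1 \<le> snd (G a (fst a, 0)) \<and> snd (G a (fst a, 0)) \<le> L1 + C"
      proof
        fix a assume a: "a \<in> S"
        then have aE: "a \<in> E" using S(1) by blast
        have "L1 \<le> snd a" "snd a \<le> L1 + w" using aE E by (auto simp: arc_family_def)
        then have "L1 \<le> snd (G a (fst a, 0)) \<and> snd (G a (fst a, 0)) \<le> L1 + C"
          using glued_period[OF EX(1,3)[OF aE] C0(2)] by (simp add: C_def)
        moreover have "ball p (2 * \<epsilon>) \<subseteq> K2" using p(2) \<epsilon>(3) subset_ball by blast
        ultimately show "fst (G a (fst a, 0)) \<in> K2 \<and>
            \<phi> (snd (G a (fst a, 0))) (fst (G a (fst a, 0))) = fst (G a (fst a, 0)) \<and>
            L1 \<le> snd (G a (fst a, 0)) \<and> snd (G a (fst a, 0)) \<le> L1 + C"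
          using glued[OF EX(1,3)[OF aE]] by blast
      qed
      show "\<forall>a\<in>S. \<forall>a'\<in>S. (\<forall>s. dist (\<phi> s (fst (G a (fst a, 0)))) (\<phi> s (fst (G a' (fst a', 0)))) \<le> e / 2) \<longrightarrow>
          a = a'"
      proof (intro ballI impI)
        fix a a' assume a: "a \<in> S" "a' \<in> S"
          "\<forall>s. dist (\<phi> s (fst (G a (fst a, 0)))) (\<phi> s (fst (G a' (fst a', 0)))) \<le> e / 2"
        have aE: "a \<in> E" "a' \<in> E" using a S(1) by auto
        show "a = a'"
          by (rule glued_first_eq[of E e a a' "(fst a, 0)" "(fst a', 0)" "e / 2"])
            (use a aE E EX(3)[OF aE(1)] EX(3)[OF aE(2)] \<epsilon> same[OF a(1,2)]
              in \<open>auto simp: arc_family_def f_def\<close>)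
      qed
    qed
    then obtain \<Gamma>2 where \<Gamma>2: "finite \<Gamma>2 \<and> \<Gamma>2 \<subseteq> orbits_meeting \<phi> K2 L1 (L1 + C)"
      "real (card S) \<le> D * L1 * real (card \<Gamma>2)" by blast
    obtain L' \<Gamma>' where L': "L1 \<le> L'" "L' \<le> L1 + C" and \<Gamma>': "\<Gamma>' \<subseteq> \<Gamma>2"
      "\<Gamma>' \<subseteq> orbits_meeting \<phi> K2 L' (L' + \<sigma>2)" "card \<Gamma>2 \<le> N2 * card \<Gamma>'"
      using N2[rule_format, OF \<Gamma>2(1)] by blast
    have "card \<Gamma> \<le> N1 * (N3 * (card F * card S))"
      using \<Gamma>1(3) E(2) S(2) by (meson le_trans mult_le_mono2)
    then have "real (card \<Gamma>) \<le> real N1 * real N3 * real (card F) * real (card S)"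
      by (metis mult.assoc of_nat_le_iff of_nat_mult)
    also have "\<dots> \<le> real N1 * real N3 * real (card F) * (D * L1 * (real N2 * real (card \<Gamma>')))"
    proof (rule mult_left_mono)
      have "D * L1 * real (card \<Gamma>2) \<le> D * L1 * (real N2 * real (card \<Gamma>'))"
        using \<Gamma>'(3) D(1) L L1 by (intro mult_left_mono) (auto simp flip: of_nat_mult)
      then show "real (card S) \<le> D * L1 * (real N2 * real (card \<Gamma>'))" using \<Gamma>2(2) by linarith
    qed simp
    also have "\<dots> = N * D * L1 * real (card \<Gamma>')" by (simp add: N_def)
    also have "\<dots> \<le> D' * L * real (card \<Gamma>')"
    proof (rule mult_right_mono)
      have "\<sigma>1 * 1 \<le> \<sigma>1 * L" using L \<sigma> by (intro mult_left_mono) auto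
      then have "L1 \<le> (1 + \<sigma>1) * L" using L1 unfolding distrib_right by linarith
      then have "N * D * L1 \<le> N * D * ((1 + \<sigma>1) * L)" using D(1) \<open>N \<ge> 0\<close> by (intro mult_left_mono) auto
      also have "\<dots> \<le> D' * L" using L by (simp add: D'_def algebra_simps)
      finally show "N * D * L1 \<le> D' * L" .
    qed simp
    finally have "real (card \<Gamma>) \<le> D' * L * real (card \<Gamma>')" .
    moreover have "finite \<Gamma>'" using \<Gamma>'(1) \<Gamma>2(1) finite_subset by blast
    ultimately show "\<exists>L' \<Gamma>'. L \<le> L' \<and> L' \<le> L + (\<sigma>1 + C) \<and> finite \<Gamma>' \<and>
        \<Gamma>' \<subseteq> orbits_meeting \<phi> K2 L' (L' + \<sigma>2) \<and> real (card \<Gamma>) \<le> D' * L * real (card \<Gamma>')"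
      using L' L1 \<Gamma>'(2) by (intro exI[of _ L'] exI[of _ \<Gamma>']) auto
  qed
qed

lemma h_Gur_mono:
  assumes K: "compact K1" "interior K2 \<noteq> {}" and \<sigma>: "\<sigma>1 > 0" "\<sigma>2 > 0"
  shows "h_Gur \<phi> K1 \<sigma>1 \<le> h_Gur \<phi> K2 \<sigma>2"
proof (rule dense_ge)
  fix y assume y: "h_Gur \<phi> K2 \<sigma>2 < y"
  obtain c where c: "h_Gur \<phi> K2 \<sigma>2 < ereal c" "ereal c < y" using ereal_dense2[OF y] by blast
  obtain c' where c': "ereal c < ereal c'" "ereal c' < y" using ereal_dense2[OF c(2)] by blast
  have cc: "c < c'" using c' by simp
  obtain C D where CD: "C \<ge> 0" "D > 0" and
    tr: "\<forall>L\<ge>1. \<forall>\<Gamma>. finite \<Gamma> \<and> \<Gamma> \<subseteq> orbits_meeting \<phi> K1 L (L + \<sigma>1) \<longrightarrow>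
    (\<exists>L' \<Gamma>'. L \<le> L' \<and> L' \<le> L + C \<and> finite \<Gamma>' \<and> \<Gamma>' \<subseteq> orbits_meeting \<phi> K2 L' (L' + \<sigma>2) \<and>
      real (card \<Gamma>) \<le> D * L * real (card \<Gamma>'))"
    using orbits_meeting_transfer[OF K \<sigma>] by (elim exE conjE)
  have "\<forall>\<^sub>F L in at_top. orbit_growth \<phi> K2 \<sigma>2 L < ereal c"
    using c(1) unfolding h_Gur_def by (rule Limsup_lessD)
  then obtain L0 where L0: "\<And>L. L \<ge> L0 \<Longrightarrow> orbit_growth \<phi> K2 \<sigma>2 L < ereal c"
    by (auto simp: eventually_at_top_linorder)
  have "\<forall>\<^sub>F L in at_top. D * exp (\<bar>c\<bar> * C) * L * exp (c * L) < exp (c' * L)"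
    using cc by (rule eventually_linear_exp_less)
  moreover have "\<forall>\<^sub>F L in at_top. L \<ge> max 1 L0" by (rule eventually_ge_at_top)
  ultimately have "\<forall>\<^sub>F L in at_top. orbit_growth \<phi> K1 \<sigma>1 L \<le> ereal c'"
  proof eventually_elim
    case (elim L)
    have "real (card \<Gamma>) \<le> exp (c' * L)" if \<Gamma>: "finite \<Gamma> \<and> \<Gamma> \<subseteq> orbits_meeting \<phi> K1 L (L + \<sigma>1)" for \<Gamma>
    proof -
      obtain L' \<Gamma>' where L': "L \<le> L'" "L' \<le> L + C" "finite \<Gamma>'" "\<Gamma>' \<subseteq> orbits_meeting \<phi> K2 L' (L' + \<sigma>2)"
        "real (card \<Gamma>) \<le> D * L * real (card \<Gamma>')"
        using tr[rule_format, OF _ \<Gamma>] elim(2) by auto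
      have "orbit_growth \<phi> K2 \<sigma>2 L' \<le> ereal c" using L0[of L'] L'(1) elim(2) by (simp add: less_imp_le)
      then have "real (card \<Gamma>') \<le> exp (c * L')"
        using orbit_growth_le_iff[of L' \<phi> K2 \<sigma>2 c] L' elim(2) by auto
      also have "\<dots> \<le> exp (\<bar>c\<bar> * C + c * L)"
      proof -
        have "c * (L' - L) \<le> \<bar>c\<bar> * C" using L'(1,2) by (intro mult_mono) auto
        then show ?thesis by (simp add: algebra_simps)
      qed
      finally have "D * L * real (card \<Gamma>') \<le> D * L * exp (\<bar>c\<bar> * C + c * L)"
        using CD elim(2) by (intro mult_left_mono) auto
      also have "\<dots> = D * exp (\<bar>c\<bar> * C) * L * exp (c * L)" by (simp add: exp_add)
      also have "\<dots> \<le> exp (c' * L)" using elim(1) by simp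
      finally show ?thesis using L'(5) by simp
    qed
    then show ?case using orbit_growth_le_iff[of L \<phi> K1 \<sigma>1 c'] elim(2) by auto
  qed
  then have "h_Gur \<phi> K1 \<sigma>1 \<le> ereal c'" unfolding h_Gur_def by (rule Limsup_bounded)
  then show "h_Gur \<phi> K1 \<sigma>1 \<le> y" using c'(2) by simp
qed

section \<open>Existence of the limit\<close>

text \<open>The seed is an arc family of some large length \<open>L0\<close> nearly realizing the upper growth rate; its
  powers under gluing, filled up with rounds of the orbit of \<open>x0\<close>, nearly realize the same rate at all
  large lengths.\<close>

lemma orbit_growth_eventually_gt:
  assumes K: "compact K" "interior K \<noteq> {}"
    and x0: "x0 \<in> K" "\<phi> \<tau> x0 = x0" "\<tau> \<ge> 1" and \<sigma>: "\<sigma> \<ge> \<tau> + 3"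
    and c: "c \<ge> 0" "ereal c < h_Gur \<phi> K \<sigma>"
  shows "\<forall>\<^sub>F L in at_top. ereal c < orbit_growth \<phi> K \<sigma> L"
proof -
  \<comment> \<open>The factor \<open>1/8\<close> leaves \<open>e / 2\<close> for the error \<open>4 * \<epsilon>\<close> of comparing arcs through glued orbits.\<close>
  obtain e w r where ewr: "0 < e" "0 < w" "w \<le> 1" "0 < r" "expansive_at K e w r"
    using expansive_scale[OF K(1)] by metis
  obtain p R where p: "R > 0" "ball p R \<subseteq> K"
    using K(2) by (meson equals0I mem_interior)
  define \<epsilon> where "\<epsilon> = min 1 (min (e / 8) (R / 2))"
  have \<epsilon>: "\<epsilon> > 0" "8 * \<epsilon> \<le> e" "2 * \<epsilon> \<le> R" "\<epsilon> \<le> 1" using ewr p by (auto simp: \<epsilon>_def)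
  have pK: "ball p (2 * \<epsilon>) \<subseteq> K" using p(2) \<epsilon>(3) subset_ball by blast
  obtain F c1 c2 c3 G where "orbit_gluing A g \<phi> K p \<epsilon> F c1 c2 c3 G"
    using orbit_gluing_exists[OF K(1) \<epsilon>(1)] by blast
  then interpret orbit_gluing A g \<phi> K p \<epsilon> F c1 c2 c3 G .
  obtain C1 D1 where C1: "C1 \<ge> 0" "D1 > (0::nat)" and
    product: "\<forall>L1 L2 E1 E2. L1 \<ge> 0 \<longrightarrow> L2 \<ge> 0 \<longrightarrow>
      arc_family K e w L1 E1 \<longrightarrow> arc_family K e w L2 E2 \<longrightarrow>
      (\<exists>L E. L1 + L2 \<le> L \<and> L \<le> L1 + L2 + C1 \<and> arc_family K e w L E \<and>
        card E1 * card E2 \<le> D1 * card E)"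
    using arc_family_product[OF K(1) pK \<epsilon>(2) ewr(2,4,5)] by (elim exE conjE)
  obtain C2 D2 where C2: "C2 \<ge> 0" "D2 > 0" and
    fill: "\<forall>L1 E L. L1 \<ge> 0 \<longrightarrow> arc_family K e w L1 E \<longrightarrow> L \<ge> L1 + C2 \<longrightarrow> L \<ge> 1 \<longrightarrow>
      (\<exists>\<Gamma>. finite \<Gamma> \<and> \<Gamma> \<subseteq> orbits_meeting \<phi> K L (L + (\<tau> + 3)) \<and>
        real (card E) \<le> D2 * L * real (card \<Gamma>))"
    using orbits_of_arc_family[OF pK \<epsilon>(2,4) ewr(2,3) x0] by (elim exE conjE)
  obtain D3 where seed: "\<forall>L>0. \<forall>\<Gamma>. finite \<Gamma> \<and> \<Gamma> \<subseteq> orbits_meeting \<phi> K L (L + w) \<longrightarrow>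
      (\<exists>E. arc_family K e w L E \<and> card \<Gamma> \<le> D3 * card E)"
    using arc_family_of_orbits[OF K(1) ewr(1,4,5)] ..
  \<comment> \<open>The losses of passing from orbits to the seed and of one gluing.\<close>
  define M where "M = real D1 * (real D3 + 1)"
  have M: "M > 0" using C1(2) by (simp add: M_def)
  obtain c' where c': "ereal c < ereal c'" "ereal c' < h_Gur \<phi> K \<sigma>" using ereal_dense2[OF c(2)] by blast
  obtain b where b: "c < b" "b < c'" using c'(1) dense by auto
  have "0 < \<sigma>" using \<sigma> x0(3) by linarith
  have "h_Gur \<phi> K \<sigma> \<le> h_Gur \<phi> K w" by (rule h_Gur_mono[OF K \<open>0 < \<sigma>\<close> ewr(2)])
  then have "ereal c' < h_Gur \<phi> K w" using c'(2) by (rule less_le_trans[rotated])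
  then have freq: "\<exists>\<^sub>F L in at_top. ereal c' < orbit_growth \<phi> K w L"
    unfolding h_Gur_def frequently_def not_less using Limsup_bounded leD by blast
  have "\<forall>\<^sub>F L in at_top. exp (b * (L + C1)) * M \<le> exp (c' * L) \<and> L \<ge> (1::real)"
  proof -
    have "\<forall>\<^sub>F L in at_top. exp (b * C1) * M * L * exp (b * L) < exp (c' * L)"
      using b(2) by (rule eventually_linear_exp_less)
    then show ?thesis using eventually_ge_at_top[of "1::real"]
    proof eventually_elim
      case (elim L)
      have "exp (b * (L + C1)) * M = exp (b * C1) * M * exp (b * L) * 1"
        by (simp add: distrib_left exp_add)
      also have "\<dots> \<le> exp (b * C1) * M * exp (b * L) * L"
        using elim(2) M by (intro mult_left_mono) auto
      finally show ?case using elim by (simp add: mult_ac)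
    qed
  qed
  from frequently_ex[OF frequently_eventually_frequently[OF freq this]]
  obtain L0 where L0: "ereal c' < orbit_growth \<phi> K w L0" "exp (b * (L0 + C1)) * M \<le> exp (c' * L0)"
    "L0 \<ge> 1" by auto
  obtain \<Gamma>0 where \<Gamma>0: "finite \<Gamma>0 \<and> \<Gamma>0 \<subseteq> orbits_meeting \<phi> K L0 (L0 + w)" "real (card \<Gamma>0) > exp (c' * L0)"
    using L0(1,3) orbit_growth_le_iff[of L0 \<phi> K w c'] by (auto simp: not_le[symmetric])
  obtain E0 where E0: "arc_family K e w L0 E0" "card \<Gamma>0 \<le> D3 * card E0"
    using seed[rule_format, OF _ \<Gamma>0(1)] L0(3) by auto
  have q: "exp (b * (L0 + C1)) * real D1 \<le> real (card E0)"
  proof -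
    have "exp (b * (L0 + C1)) * real D1 * (real D3 + 1) < real (card \<Gamma>0)"
      using L0(2) \<Gamma>0(2) by (simp add: M_def mult.assoc)
    also have "real (card \<Gamma>0) \<le> real D3 * real (card E0)" using E0(2) by (metis of_nat_le_iff of_nat_mult)
    also have "\<dots> \<le> real (card E0) * (real D3 + 1)" by (simp add: algebra_simps)
    finally show ?thesis by simp
  qed
  \<comment> \<open>Each gluing with the seed multiplies the cardinality by at least \<open>exp (b * (L0 + C1))\<close> and adds
    at most \<open>L0 + C1\<close> to the length.\<close>
  have powers: "\<exists>L E. 0 \<le> L \<and> L \<le> real (Suc n) * (L0 + C1) \<and> arc_family K e w L E \<and>
      exp (b * (real (Suc n) * (L0 + C1))) \<le> real (card E)" for n
  proof (induction n)
    case 0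
    have "exp (b * (L0 + C1)) * 1 \<le> exp (b * (L0 + C1)) * real D1"
      using C1(2) by (intro mult_left_mono) auto
    then have "exp (b * (L0 + C1)) \<le> real (card E0)" using q by linarith
    then show ?case using E0(1) L0(3) C1(1) by (intro exI[of _ L0] exI[of _ E0]) auto
  next
    case (Suc n)
    then obtain L E where LE: "0 \<le> L" "L \<le> real (Suc n) * (L0 + C1)" "arc_family K e w L E"
      "exp (b * (real (Suc n) * (L0 + C1))) \<le> real (card E)" by blast
    obtain L' E' where LE': "L + L0 \<le> L'" "L' \<le> L + L0 + C1" "arc_family K e w L' E'"
      "card E * card E0 \<le> D1 * card E'"
      using product[rule_format, OF LE(1) _ LE(3) E0(1)] L0(3) by auto
    have "exp (b * (real (Suc (Suc n)) * (L0 + C1))) * real D1 =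
        exp (b * (real (Suc n) * (L0 + C1))) * (exp (b * (L0 + C1)) * real D1)"
      by (simp add: exp_add[symmetric] algebra_simps)
    also have "\<dots> \<le> real (card E) * real (card E0)" using LE(4) q by (intro mult_mono) auto
    also have "\<dots> \<le> real (card E') * real D1" using LE'(4) by (metis mult.commute of_nat_le_iff of_nat_mult)
    finally have "exp (b * (real (Suc (Suc n)) * (L0 + C1))) \<le> real (card E')" using C1(2) by simp
    moreover have "L' \<le> real (Suc (Suc n)) * (L0 + C1)" using LE(2) LE'(2) by (simp add: algebra_simps)
    ultimately show ?case using LE'(1,3) LE(1) L0(3) by (intro exI[of _ L'] exI[of _ E']) auto
  qed
  define P where "P = L0 + C1"
  have P: "P \<ge> 1" using L0(3) C1(1) by (simp add: P_def)
  have "\<forall>\<^sub>F L in at_top. exp (c * L) * (D2 * L) < exp (b * (L - C2 - P)) \<and> L \<ge> C2 + P + 1"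
  proof -
    have "\<forall>\<^sub>F L in at_top. D2 * exp (b * (C2 + P)) * L * exp (c * L) < exp (b * L)"
      using b(1) by (rule eventually_linear_exp_less)
    then show ?thesis using eventually_ge_at_top[of "C2 + P + 1"]
    proof eventually_elim
      case (elim L)
      have "exp (b * L) = exp (b * (L - C2 - P)) * exp (b * (C2 + P))"
        by (simp add: exp_add[symmetric] algebra_simps)
      then have "(exp (c * L) * (D2 * L)) * exp (b * (C2 + P)) <
          exp (b * (L - C2 - P)) * exp (b * (C2 + P))"
        using elim(1) by (simp add: mult_ac)
      then show ?case using elim(2) by simp
    qed
  qed
  then show ?thesis
  proof eventually_elim
    case (elim L)
    \<comment> \<open>The largest power whose length is at most \<open>L - C2\<close> for certain.\<close>
    define n where "n = nat \<lfloor>(L - C2) / P\<rfloor> - 1"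
    have "(L - C2) / P \<ge> 1" using elim P by simp
    then have "real (Suc n) = of_int \<lfloor>(L - C2) / P\<rfloor>" by (simp add: n_def le_floor_iff)
    then have "real (Suc n) \<le> (L - C2) / P" "(L - C2) / P < real (Suc n) + 1" by linarith+
    then have n: "real (Suc n) * P \<le> L - C2" "L - C2 - P < real (Suc n) * P"
      using P by (auto simp: field_simps)
    obtain L1 E where E: "0 \<le> L1" "L1 \<le> real (Suc n) * P" "arc_family K e w L1 E"
      "exp (b * (real (Suc n) * P)) \<le> real (card E)"
      using powers[of n] unfolding P_def by blast
    obtain \<Gamma> where \<Gamma>: "finite \<Gamma>" "\<Gamma> \<subseteq> orbits_meeting \<phi> K L (L + (\<tau> + 3))"
      "real (card E) \<le> D2 * L * real (card \<Gamma>)"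
      using fill[rule_format, OF E(1,3), of L] E(2) n(1) elim P C2(1) by auto
    have "exp (c * L) * (D2 * L) < exp (b * (L - C2 - P))" using elim by blast
    also have "\<dots> \<le> exp (b * (real (Suc n) * P))" using n(2) b c(1) by (simp add: mult_left_mono)
    also have "\<dots> \<le> real (card \<Gamma>) * (D2 * L)" using E(4) \<Gamma>(3) by (simp add: mult_ac)
    finally have "exp (c * L) < real (card \<Gamma>)"
      using C2 P elim by (smt (verit) mult_less_cancel_right_pos mult_pos_pos)
    moreover have "\<Gamma> \<subseteq> orbits_meeting \<phi> K L (L + \<sigma>)"
      using \<Gamma>(2) \<sigma> by (auto simp: orbits_meeting_def)
    ultimately show ?case using orbit_growth_gtI[OF _ \<Gamma>(1)] elim C2(1) P by auto
  qed
qed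

text \<open>Every set with interior points meets a periodic orbit of period at least \<open>1\<close>.\<close>

lemma periodic_orbit_exists:
  assumes K: "interior K \<noteq> {}"
  obtains x T where "x \<in> K" "\<phi> T x = x" "T \<ge> 1"
proof -
  obtain p R where p: "R > 0" "ball p R \<subseteq> K"
    using K by (meson equals0I mem_interior)
  obtain F c1 c2 c3 G where "orbit_gluing A g \<phi> {p} p (R / 2) F c1 c2 c3 G"
    using orbit_gluing_exists[of "{p}" "R / 2" p] p(1) by auto
  then interpret orbit_gluing A g \<phi> "{p}" p "R / 2" F c1 c2 c3 G .
  obtain C0 where C0: "\<And>c. c \<in> F \<Longrightarrow> c \<le> C0" using transition_bound by blast
  have a: "(p, 0) \<in> closed_arcs {p}" by (simp add: closed_arcs_def)
  show thesis
    by (rule that[of "fst (G (p, 0) (p, 0))" "snd (G (p, 0) (p, 0))"])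
      (use glued[OF a a] glued_period(1)[OF a a C0] p(2) in auto)
qed

text \<open>An orbit with period less than one above the shortest one is good enough below, so it need not be
  shown that the infimum is attained.\<close>

lemma near_shortest_period:
  assumes "interior K \<noteq> {}"
  obtains x T where "x \<in> K" "\<phi> T x = x" "1 \<le> T" "T < shortest_period \<phi> K + 1" "1 \<le> shortest_period \<phi> K"
proof -
  define P where "P = {snd \<gamma> | \<gamma>. \<gamma> \<in> periodic_orbits \<phi> \<and> snd \<gamma> \<ge> 1 \<and> fst \<gamma> \<inter> K \<noteq> {}}"
  have sp: "shortest_period \<phi> K = Inf P" by (simp add: shortest_period_def P_def)
  obtain y S where "y \<in> K" "\<phi> S y = y" "S \<ge> 1" using periodic_orbit_exists[OF assms] .
  then have "S \<in> P" unfolding P_def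
    using orbits_meetingI[of y K S 1 S] by (force simp: orbits_meeting_def)
  then have ne: "P \<noteq> {}" by blast
  then obtain T where T: "T \<in> P" "T < Inf P + 1"
    using cInf_lessD[OF ne, of "Inf P + 1"] by auto
  have "1 \<le> Inf P" using ne by (rule cInf_greatest) (auto simp: P_def)
  obtain \<gamma> where \<gamma>: "\<gamma> \<in> periodic_orbits \<phi>" "snd \<gamma> = T" "T \<ge> 1" "fst \<gamma> \<inter> K \<noteq> {}"
    using T(1) unfolding P_def by blast
  then have \<gamma>: "\<gamma> \<in> orbits_meeting \<phi> K 1 T" "snd \<gamma> = T" by (simp_all add: orbits_meeting_def)
  obtain x where "x \<in> K" "\<phi> T x = x" using orbits_meetingE[OF \<gamma>(1)] \<gamma>(2) by metis
  then show thesis using T \<open>1 \<le> Inf P\<close> by (intro that[of x T]) (auto simp: sp P_def)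
qed

text \<open>Some multiple of the given orbit has its period in \<open>[L, L + \<sigma>]\<close>.\<close>

lemma orbit_growth_nonneg:
  assumes x: "x \<in> K" "\<phi> \<tau> x = x" "\<tau> \<ge> 1" and \<sigma>: "\<sigma> \<ge> \<tau>" and L: "L > 0" and c: "c < 0"
  shows "ereal c < orbit_growth \<phi> K \<sigma> L"
proof -
  define n where "n = nat \<lceil>L / \<tau>\<rceil>"
  have "L / \<tau> \<ge> 0" using L x(3) by simp
  then have "L / \<tau> \<le> real n" "real n < L / \<tau> + 1" unfolding n_def by linarith+
  then have n: "L \<le> real n * \<tau>" "real n * \<tau> < L + \<tau>" using x(3) by (auto simp: field_simps)
  have "(orb x, real n * \<tau>) \<in> orbits_meeting \<phi> K L (L + \<sigma>)"
    using n \<sigma> L x by (intro orbits_meetingI flow_multiple) auto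
  then show ?thesis
    using orbit_growth_gtI[of L "{(orb x, real n * \<tau>)}" \<phi> K \<sigma> c] L c by (simp add: mult_neg_pos)
qed

end

theorem theorem3p10:
  fixes A :: "('a::metric_space, 'e::euclidean_space) chart set"
    and g :: "('a, 'e) chart \<Rightarrow> 'e \<Rightarrow> 'e \<Rightarrow> 'e \<Rightarrow> real"
    and \<phi> :: "real \<Rightarrow> 'a \<Rightarrow> 'a"
  assumes "H_flow A g \<phi>"
  shows "\<exists>h :: ereal.
    (\<forall>K \<sigma>. compact K \<and> interior K \<noteq> {} \<and> \<sigma> > 0 \<longrightarrow> h_Gur \<phi> K \<sigma> = h) \<and>
    (\<forall>K \<sigma>. compact K \<and> interior K \<noteq> {} \<and> \<sigma> \<ge> 5 * shortest_period \<phi> K \<longrightarrow>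
       (orbit_growth \<phi> K \<sigma> \<longlongrightarrow> h) at_top)"
proof (cases "\<exists>K0 :: 'a set. compact K0 \<and> interior K0 \<noteq> {}")
  case False
  then show ?thesis by blast
next
  case True
  interpret H_flow A g \<phi> by fact
  obtain K0 :: "'a set" where K0: "compact K0" "interior K0 \<noteq> {}" using True by blast
  define h where "h = h_Gur \<phi> K0 1"
  have h: "h_Gur \<phi> K \<sigma> = h" if "compact K" "interior K \<noteq> {}" "\<sigma> > 0" for K \<sigma>
    unfolding h_def using that K0 by (intro antisym h_Gur_mono) auto
  have lim: "(orbit_growth \<phi> K \<sigma> \<longlongrightarrow> h) at_top"
    if K: "compact K" "interior K \<noteq> {}" and \<sigma>: "\<sigma> \<ge> 5 * shortest_period \<phi> K" for K \<sigma>
  proof -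
    obtain x T where x: "x \<in> K" "\<phi> T x = x" "1 \<le> T" and
      T: "T < shortest_period \<phi> K + 1" "1 \<le> shortest_period \<phi> K"
      using near_shortest_period[OF K(2)] .
    \<comment> \<open>The shortest period \<open>P\<close> is at least \<open>1\<close>, so \<open>T + 3 < P + 4 \<le> 5 * P\<close>.\<close>
    have \<sigma>T: "\<sigma> \<ge> T + 3" "\<sigma> > 0" using \<sigma> T by linarith+
    note h\<sigma> = h[OF K \<sigma>T(2)]
    show ?thesis
    proof (rule order_tendstoI)
      fix y assume "y < h"
      then obtain c where c: "y < ereal c" "ereal c < h" using ereal_dense2 by blast
      have "\<forall>\<^sub>F L in at_top. ereal c < orbit_growth \<phi> K \<sigma> L"
      proof (cases "c \<ge> 0")
        case True
        then show ?thesis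
          using orbit_growth_eventually_gt[OF K x \<sigma>T(1), of c] c(2) h\<sigma> by simp
      next
        case False
        have "\<forall>\<^sub>F L in at_top. L > (0::real)" by (rule eventually_gt_at_top)
        then show ?thesis
          by eventually_elim (use orbit_growth_nonneg[OF x, of \<sigma> _ c] \<sigma>T(1) False in auto)
      qed
      then show "\<forall>\<^sub>F L in at_top. y < orbit_growth \<phi> K \<sigma> L"
        by eventually_elim (use c(1) in simp)
    next
      fix y assume "h < y"
      then show "\<forall>\<^sub>F L in at_top. orbit_growth \<phi> K \<sigma> L < y"
        using h\<sigma> unfolding h_Gur_def by (intro Limsup_lessD) simp
    qed
  qed
  show ?thesis
  proof (intro exI[of _ h] conjI allI impI)
    show "h_Gur \<phi> K \<sigma> = h" if "compact K \<and> interior K \<noteq> {} \<and> \<sigma> > 0" for K \<sigma>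
      using h that by simp
    show "(orbit_growth \<phi> K \<sigma> \<longlongrightarrow> h) at_top"
      if "compact K \<and> interior K \<noteq> {} \<and> \<sigma> \<ge> 5 * shortest_period \<phi> K" for K \<sigma>
      using lim that by simp
  qed
qed

end
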